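(* Let $f_1,\dots,f_n:\mathbb{R}^d\to\mathbb{R}$ be convex and differentiable with $f_j$ being $\mathbf{M}_j$-smooth, $f:=\frac1n\sum_{i=1}^nf_i$, $\psi:\mathbb{R}^d\to\mathbb{R}\cup\{+\infty\}$ convex, and $x^*$ a minimizer of $f+\psi$. Let $x^0\in\mathbb{R}^d$ and let $\mathbf{W}$ be a projection matrix such that $\psi(x)=\psi'(x)$ for $x\in x^0+\mathrm{Range}(\mathbf{W})$ and $\psi(x)=+\infty$ otherwise, for some convex $\psi'$. Let $f$ be $\sigma'$-strongly convex over $x^0+\mathrm{Range}(\mathbf{W})$. Suppose that $(\mathcal{M}^\dagger)^{1/2}$ commutes with $\mathcal{S}$. Let $\alpha>0$ and a linear operator $\mathcal{B}:\mathbb{R}^{d\times n}\to\mathbb{R}^{d\times n}$ that commutes with $\mathcal{S}$ be such that for every $\mathbf{X}\in\mathbb{R}^{d\times n}$ $$\frac{2\alpha}{n^2}\mathbb{E}\left[\|(\mathcal{U}\mathbf{X})e\|_{\mathbf{W}}^2\right]+\left\|(\mathcal{I}-\mathbb{E}[\mathcal{S}])^{1/2}\mathcal{B}(\mathcal{M}^\dagger)^{1/2}\mathbf{X}\right\|^2\le(1-\alpha\sigma')\left\|\mathcal{B}(\mathcal{M}^\dagger)^{1/2}\mathbf{X}\right\|^2,$$ $$\frac{2\alpha}{n^2}\mathbb{E}\left[\|(\mathcal{U}\mathbf{X})e\|_{\mathbf{W}}^2\right]+\left\|(\mathbb{E}[\mathcal{S}])^{1/2}\mathcal{B}(\mathcal{M}^\dagger)^{1/2}\mathbf{X}\right\|^2\le\frac1n\left\|(\mathcal{M}^\dagger)^{1/2}\mathbf{X}\right\|^2.$$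 Then the iterates of GJS with stepsize $\alpha$ satisfy, for all $k\ge0$, $\mathbb{E}[\Psi^k]\le(1-\alpha\sigma')^k\Psi^0$, where $$\Psi^k:=\|x^k-x^*\|^2+\alpha\left\|\mathcal{B}(\mathcal{M}^\dagger)^{1/2}\left(\mathbf{J}^k-\mathbf{G}(x^* )\right)\right\|^2.$$
   Context: Notation: $\|\cdot\|$ is the Euclidean norm of a vector or the Frobenius norm of a matrix; $\|x\|_{\mathbf{A}}^2=\langle\mathbf{A}x,x\rangle$; $e\in\mathbb{R}^n$ is the vector of ones; $\mathcal{I}$ is the identity operator; $\dagger$ is the Moore–Penrose pseudoinverse. Projection matrix means symmetric idempotent matrix; each $\mathbf{M}_j$ is symmetric positive semidefinite. $\mathbf{M}_j$-smooth: $f_j(x)\le f_j(y)+\langle\nabla f_j(y),x-y\rangle+\frac12\|x-y\|^2_{\mathbf{M}_j}$ for all $x,y\in\mathbb{R}^d$. $\sigma'$-strongly convex over $x^0+\mathrm{Range}(\mathbf{W})$: $f(x)\ge f(y)+\langle\nabla f(y),x-y\rangle+\frac{\sigma'}2\|x-y\|^2$ for all $x,y\in x^0+\mathrm{Range}(\mathbf{W})$. $\mathbf{G}(x)=[\nabla f_1(x),\dots,\nabla f_n(x)]\in\mathbb{R}^{d\times n}$. $\mathcal{M}:\mathbb{R}^{d\times n}\to\mathbb{R}^{d\times n}$ is the linear operator $(\mathcal{M}\mathbf{X})_{:j}=\mathbf{M}_j\mathbf{X}_{:j}$. $\mathcal{U}$ is a random linear operator on $\mathbb{R}^{d\times n}$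 with $\mathbb{E}[\mathcal{U}]=\mathcal{I}$; $\mathcal{S}$ is a random (orthogonal) projection operator on $\mathbb{R}^{d\times n}$. Commuting with $\mathcal{S}$ means commuting with every realization. GJS (Generalized JacSketch): given $x^0\in\mathbb{R}^d$, $\mathbf{J}^0\in\mathbb{R}^{d\times n}$, for $k=0,1,\dots$ sample fresh independent (across iterations) realizations of $(\mathcal{S},\mathcal{U})$ and set $$\mathbf{J}^{k+1}=\mathbf{J}^k-\mathcal{S}(\mathbf{J}^k-\mathbf{G}(x^k)),\quad g^k=\tfrac1n\mathbf{J}^ke+\tfrac1n\,\mathcal{U}(\mathbf{G}(x^k)-\mathbf{J}^k)\,e,\quad x^{k+1}=\mathrm{prox}_{\alpha\psi}(x^k-\alpha g^k),$$ where $\mathrm{prox}_{\alpha\psi}(x)=\arg\min_y\{\alpha\psi(y)+\frac12\|y-x\|^2\}$ is assumed well defined (e.g. $\psi$ proper, closed, convex). *)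

theory Defs
  imports "HOL-Probability.Probability"
begin

section \<open>Linear operators on a Euclidean space\<close>

definition selfadjoint :: "('a::euclidean_space \<Rightarrow> 'a) \<Rightarrow> bool" where
  "selfadjoint T \<longleftrightarrow> linear T \<and> (\<forall>x y. T x \<bullet> y = x \<bullet> T y)"

definition psd_op :: "('a::euclidean_space \<Rightarrow> 'a) \<Rightarrow> bool" where
  "psd_op T \<longleftrightarrow> selfadjoint T \<and> (\<forall>x. 0 \<le> T x \<bullet> x)"

definition orth_projection :: "('a::euclidean_space \<Rightarrow> 'a) \<Rightarrow> bool" where
  "orth_projection T \<longleftrightarrow> selfadjoint T \<and> T \<circ> T = T"

text \<open>The Moore-Penrose pseudoinverse, by the four Penrose conditions, which determine a unique
  linear operator for every linear \<open>A\<close>.\<close>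

definition is_pinv :: "('a::euclidean_space \<Rightarrow> 'a) \<Rightarrow> ('a \<Rightarrow> 'a) \<Rightarrow> bool" where
  "is_pinv A P \<longleftrightarrow> linear P \<and> A \<circ> P \<circ> A = A \<and> P \<circ> A \<circ> P = P
     \<and> selfadjoint (A \<circ> P) \<and> selfadjoint (P \<circ> A)"

definition pinv :: "('a::euclidean_space \<Rightarrow> 'a) \<Rightarrow> ('a \<Rightarrow> 'a)" where
  "pinv A = (THE P. is_pinv A P)"

text \<open>The positive semidefinite square root; meaningful for positive semidefinite \<open>A\<close>, for which
  it exists and is unique.\<close>

definition psd_sqrt :: "('a::euclidean_space \<Rightarrow> 'a) \<Rightarrow> ('a \<Rightarrow> 'a)" where
  "psd_sqrt A = (THE R. psd_op R \<and> R \<circ> R = A)"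

text \<open>The expectation is taken pointwise, because \<open>blinfun\<close> has no instance of
  \<open>second_countable_topology\<close>, which the Bochner integral requires. As the space is
  finite-dimensional, this is the same operator.\<close>

definition op_expectation ::
    "'w measure \<Rightarrow> ('w \<Rightarrow> 'a::euclidean_space \<Rightarrow>\<^sub>L 'a) \<Rightarrow> ('a \<Rightarrow> 'a)" where
  "op_expectation D T = (\<lambda>X. integral\<^sup>L D (\<lambda>\<omega>. blinfun_apply (T \<omega>) X))"


section \<open>Matrices\<close>

definition psd_matrix :: "real^'d^'d \<Rightarrow> bool" where
  "psd_matrix A \<longleftrightarrow> transpose A = A \<and> (\<forall>v. 0 \<le> (A *v v) \<bullet> v)"

definition projection_matrix :: "real^'d^'d \<Rightarrow> bool" where
  "projection_matrix A \<longleftrightarrow> transpose A = A \<and> A ** A = A"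

definition sqnorm :: "real^'d^'d \<Rightarrow> real^'d \<Rightarrow> real" where
  "sqnorm A x = (A *v x) \<bullet> x"

text \<open>A \<open>d \<times> n\<close> matrix has type \<open>real^'n^'d\<close>, on which \<open>norm\<close> is the Frobenius norm.\<close>

definition columnwise_op :: "('n \<Rightarrow> real^'d^'d) \<Rightarrow> real^'n^'d \<Rightarrow> real^'n^'d" where
  "columnwise_op A X = (\<chi> i j. (A j *v column j X) $ i)"

definition affine_range :: "real^'d \<Rightarrow> real^'d^'d \<Rightarrow> (real^'d) set" where
  "affine_range x0 W = {x0 + W *v z | z. True}"


section \<open>Functions\<close>

definition gradient :: "('a::euclidean_space \<Rightarrow> real) \<Rightarrow> 'a \<Rightarrow> 'a" where
  "gradient f x = (THE D. GDERIV f x :> D)"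

definition smooth_wrt :: "real^'d^'d \<Rightarrow> (real^'d \<Rightarrow> real) \<Rightarrow> bool" where
  "smooth_wrt A f \<longleftrightarrow>
     (\<forall>x y. f x \<le> f y + gradient f y \<bullet> (x - y) + 1/2 * sqnorm A (x - y))"

definition strongly_convex_over :: "real \<Rightarrow> (real^'d) set \<Rightarrow> (real^'d \<Rightarrow> real) \<Rightarrow> bool" where
  "strongly_convex_over \<sigma> L f \<longleftrightarrow>
     (\<forall>x\<in>L. \<forall>y\<in>L. f x \<ge> f y + gradient f y \<bullet> (x - y) + \<sigma>/2 * (norm (x - y))\<^sup>2)"

text \<open>Convexity of a function with values in \<open>(-\<infinity>, \<infinity>]\<close>; excluding \<open>-\<infinity>\<close> is part of the notion.
  The convention \<open>0 * \<infinity> = 0\<close> for \<open>ereal\<close> makes the cases \<open>u = 0\<close> and \<open>v = 0\<close> trivial.\<close>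

definition ereal_convex :: "('a::real_vector \<Rightarrow> ereal) \<Rightarrow> bool" where
  "ereal_convex \<psi> \<longleftrightarrow> (\<forall>x. \<psi> x \<noteq> -\<infinity>) \<and>
     (\<forall>x y. \<forall>u\<ge>0. \<forall>v\<ge>0. u + v = 1 \<longrightarrow>
        \<psi> (u *\<^sub>R x + v *\<^sub>R y) \<le> ereal u * \<psi> x + ereal v * \<psi> y)"

definition prox_objective :: "real \<Rightarrow> (real^'d \<Rightarrow> ereal) \<Rightarrow> real^'d \<Rightarrow> real^'d \<Rightarrow> ereal" where
  "prox_objective \<alpha> \<psi> x y = ereal \<alpha> * \<psi> y + ereal (1/2 * (norm (y - x))\<^sup>2)"

definition prox_well_defined :: "real \<Rightarrow> (real^'d \<Rightarrow> ereal) \<Rightarrow> bool" where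
  "prox_well_defined \<alpha> \<psi> \<longleftrightarrow> (\<forall>x. \<exists>!y. is_arg_min (prox_objective \<alpha> \<psi> x) (\<lambda>_. True) y)"

definition prox :: "real \<Rightarrow> (real^'d \<Rightarrow> ereal) \<Rightarrow> real^'d \<Rightarrow> real^'d" where
  "prox \<alpha> \<psi> x = arg_min (prox_objective \<alpha> \<psi> x) (\<lambda>_. True)"

definition average :: "('n::finite \<Rightarrow> 'a \<Rightarrow> real) \<Rightarrow> 'a \<Rightarrow> real" where
  "average f x = 1 / real CARD('n) * (\<Sum>j\<in>UNIV. f j x)"

definition grad_matrix :: "('n \<Rightarrow> real^'d \<Rightarrow> real) \<Rightarrow> real^'d \<Rightarrow> real^'n^'d" where
  "grad_matrix f x = (\<chi> i j. gradient (f j) x $ i)"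


section \<open>Generalized JacSketch\<close>

type_synonym ('d, 'n) matrix_op = "(real^'n^'d) \<Rightarrow>\<^sub>L (real^'n^'d)"

text \<open>\<open>vec 1\<close> is the vector of ones.\<close>

definition gjs_estimator ::
    "('n::finite \<Rightarrow> real^'d \<Rightarrow> real) \<Rightarrow> ('d::finite, 'n) matrix_op
       \<Rightarrow> real^'d \<Rightarrow> real^'n^'d \<Rightarrow> real^'d" where
  "gjs_estimator f U x J =
     (1 / real CARD('n)) *\<^sub>R (J *v vec 1)
     + (1 / real CARD('n)) *\<^sub>R (blinfun_apply U (grad_matrix f x - J) *v vec 1)"

text \<open>The pair \<open>(x\<^sup>k, J\<^sup>k)\<close>, for given realizations \<open>S k\<close> and \<open>U k\<close> of the random operators.\<close>

primrec gjs ::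
    "('n::finite \<Rightarrow> real^'d \<Rightarrow> real) \<Rightarrow> (real^'d \<Rightarrow> ereal) \<Rightarrow> real \<Rightarrow> real^'d \<Rightarrow> real^'n^'d
       \<Rightarrow> (nat \<Rightarrow> ('d::finite, 'n) matrix_op) \<Rightarrow> (nat \<Rightarrow> ('d, 'n) matrix_op)
       \<Rightarrow> nat \<Rightarrow> (real^'d) \<times> (real^'n^'d)" where
  "gjs f \<psi> \<alpha> x0 J0 S U 0 = (x0, J0)"
| "gjs f \<psi> \<alpha> x0 J0 S U (Suc k) =
     (let (x, J) = gjs f \<psi> \<alpha> x0 J0 S U k
      in (prox \<alpha> \<psi> (x - \<alpha> *\<^sub>R gjs_estimator f (U k) x J),
          J - blinfun_apply (S k) (J - grad_matrix f x)))"

definition gjs_lyapunov ::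
    "('n::finite \<Rightarrow> real^'d^'d) \<Rightarrow> (real^'n^'d \<Rightarrow> real^'n^'d) \<Rightarrow> ('n \<Rightarrow> real^'d \<Rightarrow> real) \<Rightarrow> real
       \<Rightarrow> real^'d \<Rightarrow> (real^'d::finite) \<times> (real^'n^'d) \<Rightarrow> real" where
  "gjs_lyapunov A B f \<alpha> xs = (\<lambda>(x, J).
     (norm (x - xs))\<^sup>2
     + \<alpha> * (norm (B (psd_sqrt (pinv (columnwise_op A)) (J - grad_matrix f xs))))\<^sup>2)"

end

theory Submission
  imports Defs
begin

text \<open>Write \<open>Y = J - G xs\<close> for the memory error and \<open>H = G x - G xs\<close> for the gradient difference. The
  theorem holds because one step with frozen state \<open>(x, J)\<close> decreases the Lyapunov function by the
  factor \<open>1 - \<alpha> * \<sigma>'\<close> in expectation.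

  For the first part of the Lyapunov function, \<open>xs\<close> is a fixed point of the proximal gradient map
  (\<open>minimizer_fixed_point\<close>), and the proximal map contracts with respect to the seminorm given by \<open>W\<close>
  (\<open>prox_contraction_W\<close>), since its values lie in a translate of the range of \<open>W\<close>. Expanding the square,
  the mean of the estimator is the gradient of the average and its error is bounded by second moments of
  \<open>U Y\<close> and \<open>U H\<close> (\<open>primal_step\<close>). For the second part, \<open>S\<close> is an orthogonal projection that commutes
  with the operators in the Lyapunov function, so its square splits into a part that sees \<open>Y\<close> and a part
  that sees \<open>H\<close> (\<open>memory_step\<close>), whose expectations are the square-root expressions in the hypotheses
  (\<open>mean_norm_square\<close>). The first hypothesis absorbs all terms with \<open>Y\<close>, the second all terms with \<open>H\<close>.
  The resulting \<open>\<alpha> / n\<close> multiple of the squared norm of the rescaled \<open>H\<close> and the required gain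
  \<open>\<alpha> * \<sigma>'\<close> come from the inner product of \<open>x - xs\<close> with the gradient difference, by strong convexity
  and cocoercivity (\<open>gradient_monotonicity\<close>).

  Two layers surround this computation. Square root and pseudoinverse are given by definite descriptions,
  so their existence is derived from an orthonormal eigenbasis (\<open>selfadjoint_eigenbasis\<close>). And the
  iteration is shown to be measurable, so that the state is independent of the next pair of operators and
  Fubini's theorem turns the bound for frozen states into a recursion for expectations
  (\<open>linear_convergence\<close>).\<close>

section \<open>Self-adjoint operators: eigenbasis, square root, pseudoinverse\<close>

lemma selfadjoint_linear: "selfadjoint T \<Longrightarrow> linear T"
  by (simp add: selfadjoint_def)

lemma selfadjoint_inner: "selfadjoint T \<Longrightarrow> T x \<bullet> y = x \<bullet> T y"
  by (simp add: selfadjoint_def)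

text \<open>For small \<open>t\<close> of the sign opposite to \<open>b\<close> the linear term would prevail.\<close>

lemma linear_coefficient_zero:
  fixes b c :: real
  assumes "\<And>t. 0 \<le> 2 * t * b + t\<^sup>2 * c"
  shows "b = 0"
proof -
  define s where "s = \<bar>c\<bar> + 1"
  have s: "s > 0" "c \<le> s"
    unfolding s_def by auto
  have "0 \<le> (2 * (- b / s) * b + (- b / s)\<^sup>2 * c) * s\<^sup>2"
    using assms[of "- b / s"] by (intro mult_nonneg_nonneg) auto
  also have "\<dots> = - 2 * b\<^sup>2 * s + b\<^sup>2 * c"
    using s by (simp add: field_simps power2_eq_square)
  also have "\<dots> \<le> - 2 * b\<^sup>2 * s + b\<^sup>2 * s"
    using mult_left_mono[OF s(2), of "b\<^sup>2"] by (simp add: mult.commute)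
  also have "\<dots> = - (b\<^sup>2 * s)" by simp
  finally have "b\<^sup>2 * s \<le> 0" by simp
  then show ?thesis
    using s by (simp add: mult_le_0_iff)
qed

text \<open>The maximum of the Rayleigh quotient \<open>T x \<bullet> x\<close> over the unit sphere of \<open>V\<close> is attained at an
  eigenvector: with \<open>lam\<close> the maximum, the form \<open>lam * (x \<bullet> x) - T x \<bullet> x\<close> is nonnegative on \<open>V\<close>
  and vanishes at the maximizer, hence so does its first variation.\<close>

lemma selfadjoint_eigenvector:
  assumes T: "selfadjoint T" and V: "subspace V" "\<And>x. x \<in> V \<Longrightarrow> T x \<in> V" and nz: "V \<noteq> {0}"
  obtains v lam where "v \<in> V" "norm v = 1" "T v = lam *\<^sub>R v"
proof -
  have lin: "linear T" using T by (rule selfadjoint_linear)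
  obtain u where u: "u \<in> V" "u \<noteq> 0"
    using nz V(1) subspace_0 by blast
  have "u /\<^sub>R norm u \<in> V \<inter> sphere 0 1"
    using u V(1) by (simp add: subspace_scale)
  then have ne: "V \<inter> sphere 0 1 \<noteq> {}" by blast
  have comp: "compact (V \<inter> sphere 0 1)"
    using closed_subspace[OF V(1)] by (simp add: closed_Int_compact)
  have cont: "continuous_on (V \<inter> sphere 0 1) (\<lambda>x. T x \<bullet> x)"
    by (intro continuous_intros linear_continuous_on) (simp add: lin linear_linear)
  obtain v where v: "v \<in> V" "norm v = 1"
    and max: "\<And>y. y \<in> V \<Longrightarrow> norm y = 1 \<Longrightarrow> T y \<bullet> y \<le> T v \<bullet> v"
    using continuous_attains_sup[OF comp ne cont] by auto
  define lam where "lam = T v \<bullet> v"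
  have form: "0 \<le> lam * (w \<bullet> w) - T w \<bullet> w" if "w \<in> V" for w
  proof (cases "w = 0")
    case False
    have "T (w /\<^sub>R norm w) \<bullet> (w /\<^sub>R norm w) \<le> lam"
      unfolding lam_def using False V(1) that by (intro max) (auto simp: subspace_scale)
    then have "(T w \<bullet> w) / (norm w)\<^sup>2 \<le> lam"
      by (simp add: linear_scale[OF lin] power2_eq_square divide_inverse mult_ac)
    then show ?thesis
      using False by (simp add: divide_le_eq power2_norm_eq_inner)
  qed (simp add: linear_0[OF lin])
  have vv: "v \<bullet> v = 1"
    using v(2) by (metis norm_eq_1)
  define w where "w = lam *\<^sub>R v - T v"
  have w: "w \<in> V"
    unfolding w_def using v V by (intro subspace_diff subspace_scale) auto
  have "(lam *\<^sub>R v - T v) \<bullet> w = 0"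
  proof (rule linear_coefficient_zero)
    fix t :: real
    have "0 \<le> lam * ((v + t *\<^sub>R w) \<bullet> (v + t *\<^sub>R w)) - T (v + t *\<^sub>R w) \<bullet> (v + t *\<^sub>R w)"
      using v w V(1) by (intro form subspace_add subspace_scale) auto
    also have "\<dots> = lam * (1 + 2 * t * (v \<bullet> w) + t\<^sup>2 * (w \<bullet> w))
        - (lam + 2 * t * (T v \<bullet> w) + t\<^sup>2 * (T w \<bullet> w))"
      using selfadjoint_inner[OF T, of w v]
      by (simp add: linear_add[OF lin] linear_scale[OF lin] inner_add_left inner_add_right vv
          lam_def inner_commute power2_eq_square algebra_simps)
    finally show "0 \<le> 2 * t * ((lam *\<^sub>R v - T v) \<bullet> w) + t\<^sup>2 * (lam * (w \<bullet> w) - T w \<bullet> w)"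
      by (simp add: inner_diff_left algebra_simps)
  qed
  then have "T v = lam *\<^sub>R v"
    unfolding w_def[symmetric] by (simp add: w_def)
  with v show ?thesis by (rule that)
qed

definition orthonormal_basis :: "'a::euclidean_space set \<Rightarrow> bool" where
  "orthonormal_basis E \<longleftrightarrow> finite E \<and> (\<forall>b\<in>E. \<forall>c\<in>E. b \<bullet> c = (if b = c then 1 else 0))
     \<and> (\<forall>x. (\<Sum>b\<in>E. (x \<bullet> b) *\<^sub>R b) = x)"

text \<open>An orthonormal set of eigenvectors of maximal size spans the space, since its orthogonal
  complement is invariant and would otherwise contain one more eigenvector.\<close>

lemma selfadjoint_eigenbasis:
  fixes T :: "'a::euclidean_space \<Rightarrow> 'a"
  assumes T: "selfadjoint T"
  obtains E lam where "orthonormal_basis E" "\<And>b. b \<in> E \<Longrightarrow> T b = lam b *\<^sub>R b"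
proof -
  have lin: "linear T" using T by (rule selfadjoint_linear)
  define Q where "Q E \<longleftrightarrow> finite E \<and> (\<forall>b\<in>E. \<forall>c\<in>E. b \<bullet> c = (if b = c then 1 else 0))
     \<and> (\<forall>b\<in>E. \<exists>l. T b = l *\<^sub>R b)" for E
  have card: "card E < Suc DIM('a)" if "Q E" for E
  proof -
    have "0 \<notin> E"
      using that unfolding Q_def by (metis inner_zero_left zero_neq_one)
    moreover have "pairwise orthogonal E"
      using that by (auto simp: Q_def pairwise_def orthogonal_def)
    ultimately have "independent E"
      by (intro pairwise_orthogonal_independent)
    then have "card E \<le> DIM('a)"
      using independent_bound by blast
    then show ?thesis by simp
  qed
  have "Q {}" by (simp add: Q_def)
  then obtain E where E: "Q E" and max: "\<And>F. Q F \<Longrightarrow> card F \<le> card E"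
    using ex_has_greatest_nat[of Q "{}" card] card by blast
  have fin: "finite E" and on: "\<And>b c. b \<in> E \<Longrightarrow> c \<in> E \<Longrightarrow> b \<bullet> c = (if b = c then 1 else 0)"
    and eig: "\<And>b. b \<in> E \<Longrightarrow> \<exists>l. T b = l *\<^sub>R b"
    using E by (auto simp: Q_def)
  define V where "V = {x. \<forall>b\<in>E. x \<bullet> b = 0}"
  have V: "subspace V"
    by (auto simp: V_def subspace_def inner_add_left)
  have inv: "T x \<in> V" if "x \<in> V" for x
  proof -
    have "T x \<bullet> b = 0" if "b \<in> E" for b
      using eig[OF that] selfadjoint_inner[OF T, of x b] \<open>x \<in> V\<close> that by (auto simp: V_def)
    then show ?thesis by (simp add: V_def)
  qed
  have "V = {0}"
  proof (rule ccontr)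
    assume "V \<noteq> {0}"
    then obtain v l where v: "v \<in> V" "norm v = 1" "T v = l *\<^sub>R v"
      using selfadjoint_eigenvector[OF T V inv] by blast
    have vv: "v \<bullet> v = 1" using v(2) by (metis norm_eq_1)
    have "v \<notin> E" using v vv by (auto simp: V_def)
    moreover have "Q (insert v E)"
      using fin on eig v vv by (auto simp: Q_def V_def inner_commute)
    ultimately show False
      using max[of "insert v E"] fin by simp
  qed
  moreover have "x - (\<Sum>b\<in>E. (x \<bullet> b) *\<^sub>R b) \<in> V" for x
  proof -
    have "(\<Sum>b\<in>E. (x \<bullet> b) *\<^sub>R b) \<bullet> c = x \<bullet> c" if "c \<in> E" for c
    proof -
      have "(\<Sum>b\<in>E. (x \<bullet> b) *\<^sub>R b) \<bullet> c = (\<Sum>b\<in>E. if b = c then x \<bullet> b else 0)"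
        unfolding inner_sum_left using on that by (intro sum.cong) auto
      then show ?thesis using fin that by simp
    qed
    then show ?thesis by (simp add: V_def inner_diff_left)
  qed
  ultimately have "orthonormal_basis E"
    using fin on by (auto simp: orthonormal_basis_def)
  moreover obtain lam where "\<And>b. b \<in> E \<Longrightarrow> T b = lam b *\<^sub>R b"
    using eig by metis
  ultimately show ?thesis by (rule that)
qed

definition diag_op :: "'a::euclidean_space set \<Rightarrow> ('a \<Rightarrow> real) \<Rightarrow> 'a \<Rightarrow> 'a" where
  "diag_op E lam x = (\<Sum>b\<in>E. (lam b * (x \<bullet> b)) *\<^sub>R b)"

lemma linear_diag_op: "linear (diag_op E lam)"
  unfolding diag_op_def
  by (intro linearI) (simp_all add: inner_add_left algebra_simps sum.distrib scaleR_sum_right)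

lemma diag_op_inner_basis:
  assumes "orthonormal_basis E" "c \<in> E"
  shows "diag_op E lam x \<bullet> c = lam c * (x \<bullet> c)"
proof -
  have "diag_op E lam x \<bullet> c = (\<Sum>b\<in>E. if b = c then lam b * (x \<bullet> b) else 0)"
    unfolding diag_op_def inner_sum_left using assms
    by (intro sum.cong) (auto simp: orthonormal_basis_def)
  then show ?thesis using assms by (simp add: orthonormal_basis_def)
qed

lemma diag_op_comp:
  assumes "orthonormal_basis E"
  shows "diag_op E lam \<circ> diag_op E mu = diag_op E (\<lambda>b. lam b * mu b)"
proof
  fix x
  show "(diag_op E lam \<circ> diag_op E mu) x = diag_op E (\<lambda>b. lam b * mu b) x"
    unfolding comp_def diag_op_def[of E lam] diag_op_def[of E "\<lambda>b. lam b * mu b"]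
    using diag_op_inner_basis[OF assms] by (intro sum.cong) (auto simp: mult_ac)
qed

lemma diag_op_inner: "diag_op E lam x \<bullet> y = (\<Sum>b\<in>E. lam b * (x \<bullet> b) * (y \<bullet> b))"
  unfolding diag_op_def inner_sum_left by (intro sum.cong) (auto simp: inner_commute)

lemma selfadjoint_diag_op: "selfadjoint (diag_op E lam)"
proof -
  have "diag_op E lam x \<bullet> y = x \<bullet> diag_op E lam y" for x y
    unfolding inner_commute[of x] diag_op_inner by (simp add: mult_ac)
  then show ?thesis
    by (simp add: selfadjoint_def linear_diag_op)
qed

lemma psd_diag_op: "(\<And>b. b \<in> E \<Longrightarrow> 0 \<le> lam b) \<Longrightarrow> psd_op (diag_op E lam)"
  by (auto simp: psd_op_def selfadjoint_diag_op diag_op_inner mult.assoc intro!: sum_nonneg)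

lemma diag_op_eqI:
  assumes E: "orthonormal_basis E" and T: "linear T" "\<And>b. b \<in> E \<Longrightarrow> T b = lam b *\<^sub>R b"
  shows "T = diag_op E lam"
proof
  fix x
  have "T x = T (\<Sum>b\<in>E. (x \<bullet> b) *\<^sub>R b)"
    using E by (simp add: orthonormal_basis_def)
  also have "\<dots> = diag_op E lam x"
    unfolding diag_op_def linear_sum[OF T(1)]
    by (intro sum.cong) (auto simp: linear_scale[OF T(1)] T(2) mult.commute)
  finally show "T x = diag_op E lam x" .
qed

lemma psd_op_diagonalize:
  assumes "psd_op T"
  obtains E lam where "orthonormal_basis E" "\<And>b. b \<in> E \<Longrightarrow> 0 \<le> lam b" "T = diag_op E lam"
proof -
  have sa: "selfadjoint T" and pos: "\<And>x. 0 \<le> T x \<bullet> x"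
    using assms by (auto simp: psd_op_def)
  obtain E lam where E: "orthonormal_basis E" and eig: "\<And>b. b \<in> E \<Longrightarrow> T b = lam b *\<^sub>R b"
    using selfadjoint_eigenbasis[OF sa] by blast
  have "0 \<le> lam b" if "b \<in> E" for b
    using pos[of b] eig[OF that] E that by (simp add: orthonormal_basis_def)
  then show ?thesis
    using that E diag_op_eqI[OF E selfadjoint_linear[OF sa] eig] by blast
qed

text \<open>A positive semidefinite root \<open>R\<close> acts as \<open>sqrt l\<close> on an eigenvector of \<open>R \<circ> R\<close> with
  eigenvalue \<open>l\<close>, because \<open>(R + sqrt l) (R - sqrt l) v = 0\<close> and \<open>R + sqrt l\<close> is injective if
  \<open>l > 0\<close>. This forces uniqueness.\<close>

lemma psd_root_eigenvector:
  assumes R: "psd_op R" and eig: "R (R v) = l *\<^sub>R v" and l: "0 \<le> l"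
  shows "R v = sqrt l *\<^sub>R v"
proof -
  have sa: "selfadjoint R" and pos: "\<And>x. 0 \<le> R x \<bullet> x"
    using R by (auto simp: psd_op_def)
  note lin = selfadjoint_linear[OF sa]
  define w where "w = R v - sqrt l *\<^sub>R v"
  have Rw: "R w = - sqrt l *\<^sub>R w"
    using l by (simp add: w_def linear_diff[OF lin] linear_scale[OF lin] eig algebra_simps)
  have "w = 0"
  proof (cases "l = 0")
    case True
    then have "R v \<bullet> R v = 0"
      using selfadjoint_inner[OF sa, of "v" "R v"] eig by simp
    then show ?thesis using True by (simp add: w_def)
  next
    case False
    have "sqrt l * (w \<bullet> w) \<le> 0"
      using pos[of w] Rw by simp
    then show ?thesis
      using l False by (simp add: mult_le_0_iff) (metis inner_eq_zero_iff inner_ge_zero order_antisym)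
  qed
  then show ?thesis by (simp add: w_def)
qed

lemma psd_sqrt:
  assumes "psd_op T"
  shows "psd_op (psd_sqrt T)" and "psd_sqrt T \<circ> psd_sqrt T = T"
proof -
  obtain E lam where E: "orthonormal_basis E" and lam: "\<And>b. b \<in> E \<Longrightarrow> 0 \<le> lam b"
    and T: "T = diag_op E lam"
    using psd_op_diagonalize[OF assms] by blast
  have "\<exists>!R. psd_op R \<and> R \<circ> R = T"
  proof (rule ex1I)
    have "diag_op E (\<lambda>b. sqrt (lam b)) \<circ> diag_op E (\<lambda>b. sqrt (lam b)) = T"
      unfolding diag_op_comp[OF E] T
      using lam by (auto simp: diag_op_def fun_eq_iff intro!: sum.cong)
    then show "psd_op (diag_op E (\<lambda>b. sqrt (lam b)))
        \<and> diag_op E (\<lambda>b. sqrt (lam b)) \<circ> diag_op E (\<lambda>b. sqrt (lam b)) = T"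
      using lam by (auto intro: psd_diag_op)
  next
    fix R assume R: "psd_op R \<and> R \<circ> R = T"
    show "R = diag_op E (\<lambda>b. sqrt (lam b))"
    proof (rule diag_op_eqI[OF E])
      show "linear R"
        using R by (auto simp: psd_op_def selfadjoint_linear)
    next
      fix b assume b: "b \<in> E"
      have "T b = (\<Sum>c\<in>E. if c = b then lam b *\<^sub>R b else 0)"
        unfolding T diag_op_def using E b by (intro sum.cong) (auto simp: orthonormal_basis_def)
      then have "T b = lam b *\<^sub>R b"
        using E b by (simp add: orthonormal_basis_def)
      then show "R b = sqrt (lam b) *\<^sub>R b"
        using R lam[OF b] by (intro psd_root_eigenvector) (auto simp: fun_eq_iff)
    qed
  qed
  then have "psd_op (psd_sqrt T) \<and> psd_sqrt T \<circ> psd_sqrt T = T"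
    unfolding psd_sqrt_def by (rule theI')
  then show "psd_op (psd_sqrt T)" "psd_sqrt T \<circ> psd_sqrt T = T" by auto
qed

lemma norm_psd_sqrt: "psd_op T \<Longrightarrow> (norm (psd_sqrt T x))\<^sup>2 = T x \<bullet> x"
  using psd_sqrt[of T] selfadjoint_inner[of "psd_sqrt T" "psd_sqrt T x" x]
  by (auto simp: psd_op_def fun_eq_iff power2_norm_eq_inner)

text \<open>\<open>P \<circ> T\<close> and \<open>Q \<circ> T\<close> are orthogonal projections with the kernel of \<open>T\<close>, and \<open>T \<circ> P\<close> and
  \<open>T \<circ> Q\<close> are orthogonal projections onto its range; hence they agree pairwise, and
  \<open>P = P \<circ> T \<circ> P = Q \<circ> T \<circ> Q = Q\<close>.\<close>

lemma is_pinv_unique: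
  assumes P: "is_pinv T P" and Q: "is_pinv T Q"
  shows "P = Q"
proof -
  have P1: "T (P (T x)) = T x" "P (T (P x)) = P x"
    and P2: "T (P x) \<bullet> y = x \<bullet> T (P y)" "P (T x) \<bullet> y = x \<bullet> P (T y)" for x y
    using P by (auto simp: is_pinv_def fun_eq_iff selfadjoint_def)
  have Q1: "T (Q (T x)) = T x" "Q (T (Q x)) = Q x"
    and Q2: "T (Q x) \<bullet> y = x \<bullet> T (Q y)" "Q (T x) \<bullet> y = x \<bullet> Q (T y)" for x y
    using Q by (auto simp: is_pinv_def fun_eq_iff selfadjoint_def)
  have 1: "P (T x) = Q (T x)" for x
  proof -
    have "P (T x) \<bullet> y = Q (T x) \<bullet> y" for y
      by (metis P1(1) P2(2) Q1(1) Q2(2))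
    then show ?thesis by (metis vector_eq_rdot)
  qed
  have 2: "T (P x) = T (Q x)" for x
  proof -
    have "T (P x) \<bullet> y = T (Q x) \<bullet> y" for y
      by (metis P1(1) P2(1) Q1(1) Q2(1))
    then show ?thesis by (metis vector_eq_rdot)
  qed
  show ?thesis
    by (rule ext) (metis 1 2 P1(2) Q1(2))
qed

lemma psd_pinv:
  assumes "psd_op T"
  shows "is_pinv T (pinv T)" and "psd_op (pinv T)"
proof -
  obtain E lam where E: "orthonormal_basis E" and lam: "\<And>b. b \<in> E \<Longrightarrow> 0 \<le> lam b"
    and T: "T = diag_op E lam"
    using psd_op_diagonalize[OF assms] by blast
  \<comment> \<open>\<open>inverse 0 = 0\<close> takes care of the kernel.\<close>
  define P where "P = diag_op E (\<lambda>b. inverse (lam b))"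
  have "(\<lambda>b. lam b * inverse (lam b) * lam b) = lam"
    "(\<lambda>b. inverse (lam b) * lam b * inverse (lam b)) = (\<lambda>b. inverse (lam b))"
    by (auto simp: fun_eq_iff field_simps)
  then have P: "is_pinv T P"
    by (simp add: is_pinv_def T P_def diag_op_comp[OF E] linear_diag_op selfadjoint_diag_op)
  then have "pinv T = P"
    unfolding pinv_def using is_pinv_unique by blast
  moreover have "psd_op P"
    unfolding P_def using lam by (intro psd_diag_op) auto
  ultimately show "is_pinv T (pinv T)" "psd_op (pinv T)"
    using P by auto
qed

section \<open>Gradients, first-order optimality and the proximal map\<close>

lemma GDERIV_gradient:
  fixes f :: "'a::euclidean_space \<Rightarrow> real"
  assumes "f differentiable (at x)"
  shows "GDERIV f x :> gradient f x"
proof -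
  obtain f' where f': "(f has_derivative f') (at x)"
    using assms by (auto simp: differentiable_def)
  have lin: "linear f'"
    using f' by (rule has_derivative_linear)
  define G where "G = (\<Sum>b\<in>Basis. f' b *\<^sub>R b)"
  have "f' h = h \<bullet> G" for h
  proof -
    have "f' h = f' (\<Sum>b\<in>Basis. (h \<bullet> b) *\<^sub>R b)"
      by (simp add: euclidean_representation)
    also have "\<dots> = h \<bullet> G"
      by (simp add: linear_sum[OF lin] linear_scale[OF lin] G_def inner_sum_right mult.commute)
    finally show ?thesis .
  qed
  then have "f' = (\<lambda>h. h \<bullet> G)" by (rule ext)
  then have G: "GDERIV f x :> G"
    using f' by (simp add: gderiv_def)
  have "D = G" if "GDERIV f x :> D" for D
  proof -
    have "(\<lambda>h. h \<bullet> D) = (\<lambda>h. h \<bullet> G)"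
      using that G by (auto simp: gderiv_def intro: has_derivative_unique)
    then show ?thesis by (metis vector_eq_ldot)
  qed
  with G show ?thesis
    unfolding gradient_def by (rule theI)
qed

lemma gradient_eqI: "GDERIV f x :> D \<Longrightarrow> gradient f x = D"
  unfolding gradient_def
proof (rule the_equality)
  fix E assume D: "GDERIV f x :> D" and E: "GDERIV f x :> E"
  have "(\<lambda>h. h \<bullet> E) = (\<lambda>h. h \<bullet> D)"
    using D E by (auto simp: gderiv_def intro: has_derivative_unique)
  then show "E = D" by (metis vector_eq_ldot)
qed

lemma GDERIV_line:
  fixes h :: "'a::euclidean_space \<Rightarrow> real"
  assumes "GDERIV h p :> D"
  shows "((\<lambda>t. (h (p + t *\<^sub>R d) - h p) / t) \<longlongrightarrow> D \<bullet> d) (at 0)"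
proof -
  have "((\<lambda>t. p + t *\<^sub>R d) has_derivative (\<lambda>t. t *\<^sub>R d)) (at 0)"
    by (auto intro!: derivative_eq_intros)
  moreover have "(h has_derivative (\<lambda>v. v \<bullet> D)) (at (p + 0 *\<^sub>R d))"
    using assms by (simp add: gderiv_def)
  ultimately have "((\<lambda>t. h (p + t *\<^sub>R d)) has_derivative (\<lambda>t. (t *\<^sub>R d) \<bullet> D)) (at 0)"
    by (rule has_derivative_compose)
  moreover have "(\<lambda>t. (t *\<^sub>R d) \<bullet> D) = (*) (D \<bullet> d)"
    by (auto simp: inner_commute)
  ultimately have "((\<lambda>t. h (p + t *\<^sub>R d)) has_field_derivative D \<bullet> d) (at 0)"
    by (simp add: has_field_derivative_def)
  then show ?thesis
    by (simp add: DERIV_def)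
qed

text \<open>Moving from the minimizer \<open>p\<close> a fraction \<open>t\<close> of the way towards \<open>y\<close> costs at most
  \<open>t * c * (b - a)\<close> in the convex part, by convexity; dividing by \<open>t\<close> and letting \<open>t\<close> tend to \<open>0\<close>
  leaves the directional derivative of the smooth part.\<close>

lemma first_order_optimality:
  fixes \<phi> :: "'a::euclidean_space \<Rightarrow> ereal"
  assumes conv: "ereal_convex \<phi>" and D: "GDERIV h p :> D" and c: "0 \<le> c"
    and min: "\<And>z. ereal c * \<phi> p + ereal (h p) \<le> ereal c * \<phi> z + ereal (h z)"
    and a: "\<phi> p = ereal a" and b: "\<phi> y = ereal b"
  shows "c * a \<le> c * b + D \<bullet> (y - p)"
proof -
  have "c * (a - b) \<le> (h (p + t *\<^sub>R (y - p)) - h p) / t" if t: "0 < t" "t < 1" for t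
  proof -
    define z where "z = p + t *\<^sub>R (y - p)"
    have z: "z = (1 - t) *\<^sub>R p + t *\<^sub>R y"
      by (simp add: z_def algebra_simps)
    have "0 \<le> 1 - t" "0 \<le> t" "1 - t + t = 1" using t by auto
    then have "\<phi> z \<le> ereal (1 - t) * \<phi> p + ereal t * \<phi> y"
      unfolding z using conv unfolding ereal_convex_def by blast
    then have le: "\<phi> z \<le> ereal ((1 - t) * a + t * b)"
      by (simp add: a b)
    moreover have "\<phi> z \<noteq> -\<infinity>"
      using conv by (simp add: ereal_convex_def)
    ultimately obtain r where r: "\<phi> z = ereal r"
      by (cases "\<phi> z") auto
    have "c * a + h p \<le> c * r + h z"
      using min[of z] by (simp add: a r)
    also have "\<dots> \<le> c * ((1 - t) * a + t * b) + h z"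
      using le r c by (simp add: mult_left_mono)
    finally have "t * (c * (a - b)) \<le> h z - h p"
      by (simp add: algebra_simps)
    then show ?thesis
      unfolding z_def[symmetric] pos_le_divide_eq[OF t(1)] by (simp add: mult.commute)
  qed
  then have "\<forall>\<^sub>F t in at_right 0. c * (a - b) \<le> (h (p + t *\<^sub>R (y - p)) - h p) / t"
    unfolding eventually_at_right_field by (intro exI[of _ 1]) auto
  moreover have "((\<lambda>t. (h (p + t *\<^sub>R (y - p)) - h p) / t) \<longlongrightarrow> D \<bullet> (y - p)) (at_right 0)"
    using GDERIV_line[OF D] by (rule filterlim_mono) (auto simp: at_le)
  ultimately have "c * (a - b) \<le> D \<bullet> (y - p)"
    by (intro tendsto_lowerbound) auto
  then show ?thesis by (simp add: algebra_simps)
qed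

text \<open>The tangent inequality is optimality of every point for \<open>f + (- f)\<close>.\<close>

lemma convex_above_tangent:
  fixes f :: "'a::euclidean_space \<Rightarrow> real"
  assumes conv: "convex_on UNIV f" and D: "GDERIV f p :> D"
  shows "f p + D \<bullet> (y - p) \<le> f y"
proof -
  have "ereal_convex (\<lambda>x. ereal (f x))"
    using conv by (auto simp: ereal_convex_def convex_on_def)
  then have "1 * f p \<le> 1 * f y + (- D) \<bullet> (y - p)"
    by (rule first_order_optimality[where h = "\<lambda>x. - f x"]) (use D in \<open>auto intro: GDERIV_minus\<close>)
  then show ?thesis by simp
qed

lemma GDERIV_half_norm_square:
  fixes p x :: "'a::euclidean_space"
  shows "GDERIV (\<lambda>y. 1/2 * (norm (y - x))\<^sup>2) p :> p - x"
  unfolding gderiv_def power2_norm_eq_inner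
  by (auto intro!: derivative_eq_intros simp: inner_commute)

lemma prox_is_arg_min:
  "prox_well_defined \<alpha> \<psi> \<Longrightarrow> is_arg_min (prox_objective \<alpha> \<psi> x) (\<lambda>_. True) (prox \<alpha> \<psi> x)"
  unfolding prox_well_defined_def prox_def arg_min_def by (metis someI_ex)

lemma prox_eqI:
  "prox_well_defined \<alpha> \<psi> \<Longrightarrow> is_arg_min (prox_objective \<alpha> \<psi> x) (\<lambda>_. True) p
    \<Longrightarrow> prox \<alpha> \<psi> x = p"
  using prox_is_arg_min[of \<alpha> \<psi> x] unfolding prox_well_defined_def by blast

text \<open>If \<open>\<psi>\<close> were constantly \<open>\<infinity>\<close>, every point would minimize the proximal objective.\<close>

lemma prox_well_defined_proper:
  fixes \<psi> :: "real^'d::finite \<Rightarrow> ereal"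
  assumes "prox_well_defined \<alpha> \<psi>" "\<alpha> > 0"
  obtains y where "\<psi> y \<noteq> \<infinity>"
proof (rule ccontr)
  assume "\<not> thesis"
  then have "\<psi> y = \<infinity>" for y using that by blast
  then have "is_arg_min (prox_objective \<alpha> \<psi> 0) (\<lambda>_. True) z" for z
    using assms(2) by (simp add: is_arg_min_def prox_objective_def)
  then have "vec 1 = (0 :: real^'d)"
    using assms(1) unfolding prox_well_defined_def by blast
  then show False by (simp add: vec_eq_iff)
qed

lemma prox_finite:
  fixes \<psi> :: "real^'d::finite \<Rightarrow> ereal"
  assumes "prox_well_defined \<alpha> \<psi>" "\<alpha> > 0" "ereal_convex \<psi>"
  obtains a where "\<psi> (prox \<alpha> \<psi> x) = ereal a"
proof -
  obtain y where y: "\<psi> y \<noteq> \<infinity>"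
    using prox_well_defined_proper[OF assms(1,2)] .
  have "prox_objective \<alpha> \<psi> x (prox \<alpha> \<psi> x) \<le> prox_objective \<alpha> \<psi> x y"
    using prox_is_arg_min[OF assms(1)] by (auto simp: is_arg_min_def not_less)
  then have "\<psi> (prox \<alpha> \<psi> x) \<noteq> \<infinity>"
    using y assms(2) by (cases "\<psi> y") (auto simp: prox_objective_def)
  moreover have "\<psi> (prox \<alpha> \<psi> x) \<noteq> -\<infinity>"
    using assms(3) by (simp add: ereal_convex_def)
  ultimately show ?thesis
    using that by (cases "\<psi> (prox \<alpha> \<psi> x)") auto
qed

lemma prox_variational:
  fixes \<psi> :: "real^'d::finite \<Rightarrow> ereal"
  assumes wd: "prox_well_defined \<alpha> \<psi>" and "\<alpha> > 0" "ereal_convex \<psi>"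
    and "\<psi> (prox \<alpha> \<psi> x) = ereal a" "\<psi> y = ereal b"
  shows "\<alpha> * a \<le> \<alpha> * b + (prox \<alpha> \<psi> x - x) \<bullet> (y - prox \<alpha> \<psi> x)"
proof (rule first_order_optimality[OF assms(3) GDERIV_half_norm_square _ _ assms(4,5)])
  fix z
  show "ereal \<alpha> * \<psi> (prox \<alpha> \<psi> x) + ereal (1/2 * (norm (prox \<alpha> \<psi> x - x))\<^sup>2)
      \<le> ereal \<alpha> * \<psi> z + ereal (1/2 * (norm (z - x))\<^sup>2)"
    using prox_is_arg_min[OF wd, of x] by (auto simp: is_arg_min_def not_less prox_objective_def)
qed (use assms in simp)

text \<open>The variational inequalities at the two points are tested against each other and added, so that
  the values of \<open>\<psi>\<close> cancel.\<close>

lemma prox_firmly_nonexpansive: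
  fixes \<psi> :: "real^'d::finite \<Rightarrow> ereal"
  assumes "prox_well_defined \<alpha> \<psi>" "\<alpha> > 0" "ereal_convex \<psi>"
  shows "(norm (prox \<alpha> \<psi> u - prox \<alpha> \<psi> v))\<^sup>2 \<le> (u - v) \<bullet> (prox \<alpha> \<psi> u - prox \<alpha> \<psi> v)"
proof -
  let ?p = "prox \<alpha> \<psi> u" and ?q = "prox \<alpha> \<psi> v"
  obtain a where a: "\<psi> ?p = ereal a" using prox_finite[OF assms] .
  obtain b where b: "\<psi> ?q = ereal b" using prox_finite[OF assms] .
  have "0 \<le> (?p - u) \<bullet> (?q - ?p) + (?q - v) \<bullet> (?p - ?q)"
    using prox_variational[OF assms a b] prox_variational[OF assms b a] by simp
  also have "\<dots> = (u - v) \<bullet> (?p - ?q) - (?p - ?q) \<bullet> (?p - ?q)"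
    by (simp add: inner_diff_left inner_diff_right inner_commute)
  finally show ?thesis by (simp add: power2_norm_eq_inner)
qed

lemma continuous_on_prox:
  fixes \<psi> :: "real^'d::finite \<Rightarrow> ereal"
  assumes "prox_well_defined \<alpha> \<psi>" "\<alpha> > 0" "ereal_convex \<psi>"
  shows "continuous_on UNIV (prox \<alpha> \<psi>)"
proof -
  have "1-lipschitz_on UNIV (prox \<alpha> \<psi>)"
  proof (rule lipschitz_onI)
    fix u v
    let ?d = "prox \<alpha> \<psi> u - prox \<alpha> \<psi> v"
    have "norm ?d * norm ?d \<le> norm (u - v) * norm ?d"
      using prox_firmly_nonexpansive[OF assms, of u v] norm_cauchy_schwarz[of "u - v" ?d]
      by (simp add: power2_eq_square)
    then have "norm ?d \<le> norm (u - v)"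
      by (cases "norm ?d = 0") (auto simp: mult_le_cancel_right)
    then show "dist (prox \<alpha> \<psi> u) (prox \<alpha> \<psi> v) \<le> 1 * dist u v"
      by (simp add: dist_norm)
  qed simp
  then show ?thesis by (rule lipschitz_on_continuous_on)
qed

lemma norm_W_square:
  assumes "projection_matrix W"
  shows "(norm (W *v v))\<^sup>2 = sqnorm W v"
proof -
  have "(norm (W *v v))\<^sup>2 = (transpose W *v (W *v v)) \<bullet> v"
    by (simp add: power2_norm_eq_inner dot_lmul_matrix)
  also have "\<dots> = sqnorm W v"
    using assms by (simp add: projection_matrix_def matrix_vector_mul_assoc sqnorm_def)
  finally show ?thesis .
qed

text \<open>The outputs of the proximal map lie in an affine subspace on which \<open>W\<close> is the identity up to
  translation, so only the \<open>W\<close>-component of the difference of the inputs is seen.\<close>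

lemma prox_contraction_W:
  fixes \<psi> :: "real^'d::finite \<Rightarrow> ereal"
  assumes pr: "prox_well_defined \<alpha> \<psi>" "\<alpha> > 0" "ereal_convex \<psi>"
    and W: "projection_matrix W" and off: "\<And>x. x \<notin> affine_range x0 W \<Longrightarrow> \<psi> x = \<infinity>"
  shows "prox \<alpha> \<psi> u \<in> affine_range x0 W"
    and "(norm (prox \<alpha> \<psi> u - prox \<alpha> \<psi> v))\<^sup>2 \<le> sqnorm W (u - v)"
proof -
  show L: "prox \<alpha> \<psi> u \<in> affine_range x0 W" for u
    using prox_finite[OF pr] off by (metis PInfty_neq_ereal(1))
  let ?d = "prox \<alpha> \<psi> u - prox \<alpha> \<psi> v"
  obtain y z where "prox \<alpha> \<psi> u = x0 + W *v y" "prox \<alpha> \<psi> v = x0 + W *v z"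
    using L[of u] L[of v] by (auto simp: affine_range_def)
  then have "?d = W *v (y - z)" by (simp add: matrix_vector_mult_diff_distrib)
  then have d: "W *v ?d = ?d"
    using W by (simp add: projection_matrix_def matrix_vector_mul_assoc)
  have "(norm ?d)\<^sup>2 \<le> (u - v) \<bullet> (W *v ?d)"
    using prox_firmly_nonexpansive[OF pr, of u v] d by simp
  also have "\<dots> = (W *v (u - v)) \<bullet> ?d"
    using W by (metis dot_lmul_matrix projection_matrix_def vector_transpose_matrix)
  also have "\<dots> \<le> norm (W *v (u - v)) * norm ?d"
    by (rule norm_cauchy_schwarz)
  finally have "norm ?d \<le> norm (W *v (u - v))"
    by (cases "norm ?d = 0") (auto simp: power2_eq_square mult_le_cancel_right)
  then have "(norm ?d)\<^sup>2 \<le> (norm (W *v (u - v)))\<^sup>2"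
    by (simp add: power_mono)
  then show "(norm ?d)\<^sup>2 \<le> sqnorm W (u - v)"
    by (simp add: norm_W_square[OF W])
qed

lemma minimizer_finite:
  fixes \<psi> :: "real^'d::finite \<Rightarrow> ereal"
  assumes "prox_well_defined \<alpha> \<psi>" "\<alpha> > 0" "ereal_convex \<psi>"
    and "is_arg_min (\<lambda>x. ereal (F x) + \<psi> x) (\<lambda>_. True) xs"
  obtains a where "\<psi> xs = ereal a"
proof -
  obtain y where y: "\<psi> y \<noteq> \<infinity>"
    using prox_well_defined_proper[OF assms(1,2)] .
  have "ereal (F xs) + \<psi> xs \<le> ereal (F y) + \<psi> y"
    using assms(4) by (auto simp: is_arg_min_def not_less)
  then have "\<psi> xs \<noteq> \<infinity>" using y by (cases "\<psi> y") auto
  moreover have "\<psi> xs \<noteq> -\<infinity>"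
    using assms(3) by (simp add: ereal_convex_def)
  ultimately show ?thesis
    using that by (cases "\<psi> xs") auto
qed

text \<open>Optimality of \<open>xs\<close> says that \<open>- G\<close> is a subgradient of \<open>\<psi>\<close> at \<open>xs\<close>, which is also the
  optimality condition of the proximal objective at \<open>xs\<close>.\<close>

lemma minimizer_fixed_point:
  fixes \<psi> :: "real^'d::finite \<Rightarrow> ereal"
  assumes pr: "prox_well_defined \<alpha> \<psi>" "\<alpha> > 0" "ereal_convex \<psi>"
    and min: "is_arg_min (\<lambda>x. ereal (F x) + \<psi> x) (\<lambda>_. True) xs"
    and G: "GDERIV F xs :> G"
  shows "prox \<alpha> \<psi> (xs - \<alpha> *\<^sub>R G) = xs"
proof (rule prox_eqI[OF pr(1)])
  obtain a where a: "\<psi> xs = ereal a"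
    using minimizer_finite[OF pr min] .
  have "prox_objective \<alpha> \<psi> (xs - \<alpha> *\<^sub>R G) xs \<le> prox_objective \<alpha> \<psi> (xs - \<alpha> *\<^sub>R G) y" for y
  proof (cases "\<psi> y")
    case (real b)
    have "1 * a \<le> 1 * b + G \<bullet> (y - xs)"
      by (rule first_order_optimality[OF pr(3) G _ _ a real])
        (use min in \<open>auto simp: is_arg_min_def not_less add.commute\<close>)
    then have "\<alpha> * a \<le> \<alpha> * b + \<alpha> * (G \<bullet> (y - xs))"
      using pr(2) by (metis distrib_left mult_left_mono less_imp_le mult_1)
    moreover have "(norm (y - (xs - \<alpha> *\<^sub>R G)))\<^sup>2
        = (norm (y - xs))\<^sup>2 + 2 * (\<alpha> * (G \<bullet> (y - xs))) + (norm (\<alpha> *\<^sub>R G))\<^sup>2"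
      unfolding power2_norm_eq_inner
      by (simp add: inner_diff_left inner_diff_right inner_add_left inner_add_right inner_commute algebra_simps)
    moreover have "xs - (xs - \<alpha> *\<^sub>R G) = \<alpha> *\<^sub>R G" by simp
    moreover have "0 \<le> (norm (y - xs))\<^sup>2" by simp
    moreover have "p + 1/2 * k \<le> r + 1/2 * m" if "p \<le> r + g" "m = N + 2 * g + k" "0 \<le> N"
      for p r g k m N :: real
      using that by linarith
    ultimately have "\<alpha> * a + 1/2 * (norm (xs - (xs - \<alpha> *\<^sub>R G)))\<^sup>2
        \<le> \<alpha> * b + 1/2 * (norm (y - (xs - \<alpha> *\<^sub>R G)))\<^sup>2"
      by simp
    then show ?thesis
      by (simp add: prox_objective_def a real)
  next
    case PInf
    then show ?thesis using pr(2) by (simp add: prox_objective_def)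
  next
    case MInf
    then show ?thesis using pr(3) by (simp add: ereal_convex_def)
  qed
  then show "is_arg_min (prox_objective \<alpha> \<psi> (xs - \<alpha> *\<^sub>R G)) (\<lambda>_. True) xs"
    by (auto simp: is_arg_min_def not_less)
qed

section \<open>Cocoercivity of the gradients\<close>

lemma column_columnwise_op: "column j (columnwise_op A X) = A j *v column j X"
  by (simp add: vec_eq_iff columnwise_op_def column_def)

lemma column_grad_matrix: "column j (grad_matrix f x) = gradient (f j) x"
  by (simp add: vec_eq_iff grad_matrix_def column_def)

lemma column_diff: "column j (X - Y) = column j X - column j Y"
  by (simp add: vec_eq_iff column_def)

lemma inner_columns:
  fixes X Y :: "real^'n^'d"
  shows "X \<bullet> Y = (\<Sum>j\<in>UNIV. column j X \<bullet> column j Y)"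
  unfolding inner_vec_def column_def by (simp add: sum.swap[of _ UNIV "UNIV :: 'n set"])

lemma psd_columnwise_op:
  fixes A :: "'n::finite \<Rightarrow> real^'d::finite^'d"
  assumes "\<And>j. psd_matrix (A j)"
  shows "psd_op (columnwise_op A)"
proof -
  have "linear (columnwise_op A)"
    by (rule linearI)
      (simp_all add: vec_eq_iff columnwise_op_def column_def matrix_vector_mult_def
        algebra_simps sum.distrib sum_distrib_left)
  moreover have "(A j *v v) \<bullet> w = v \<bullet> (A j *v w)" for j v w
    using assms[of j] by (metis dot_lmul_matrix psd_matrix_def vector_transpose_matrix)
  ultimately show ?thesis
    using assms
    by (auto simp: psd_op_def selfadjoint_def inner_columns column_columnwise_op psd_matrix_def
        intro!: sum_nonneg)
qed

lemma gradient_average: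
  fixes f :: "'n::finite \<Rightarrow> real^'d::finite \<Rightarrow> real"
  assumes "\<And>j. f j differentiable (at x)"
  shows "GDERIV (average f) x :> (1 / real CARD('n)) *\<^sub>R (grad_matrix f x *v vec 1)"
    and "gradient (average f) x = (1 / real CARD('n)) *\<^sub>R (grad_matrix f x *v vec 1)"
proof -
  have e: "grad_matrix f x *v vec 1 = (\<Sum>j\<in>UNIV. gradient (f j) x)"
    by (simp add: vec_eq_iff grad_matrix_def matrix_vector_mult_def)
  have "(f j has_derivative (\<lambda>h. h \<bullet> gradient (f j) x)) (at x)" for j
    using GDERIV_gradient[OF assms] by (simp add: gderiv_def)
  then show "GDERIV (average f) x :> (1 / real CARD('n)) *\<^sub>R (grad_matrix f x *v vec 1)"
    unfolding gderiv_def e average_def[abs_def] inner_scaleR_right inner_sum_right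
    by (intro has_derivative_mult_right has_derivative_sum) auto
  then show "gradient (average f) x = (1 / real CARD('n)) *\<^sub>R (grad_matrix f x *v vec 1)"
    by (rule gradient_eqI)
qed

text \<open>At \<open>x - z\<close> the convexity bound from below at \<open>y\<close> meets the smoothness bound from above at
  \<open>x\<close>. Here \<open>z\<close> is taken, for each \<open>j\<close>, as the \<open>j\<close>-th column of the pseudoinverse of the columnwise
  operator applied to the difference of the gradients, which minimizes the sum of the upper bounds.\<close>

lemma cocoercivity:
  fixes f :: "'n::finite \<Rightarrow> real^'d::finite \<Rightarrow> real"
  assumes psd: "\<And>j. psd_matrix (A j)" and conv: "\<And>j. convex_on UNIV (f j)"
    and diff: "\<And>j x. f j differentiable (at x)" and smooth: "\<And>j. smooth_wrt (A j) (f j)"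
  shows "(\<Sum>j\<in>UNIV. f j y + gradient (f j) y \<bullet> (x - y))
      + 1/2 * (norm (psd_sqrt (pinv (columnwise_op A)) (grad_matrix f x - grad_matrix f y)))\<^sup>2
    \<le> (\<Sum>j\<in>UNIV. f j x)"
proof -
  define M where "M = columnwise_op A"
  have M: "psd_op M" unfolding M_def using psd by (rule psd_columnwise_op)
  define H where "H = grad_matrix f x - grad_matrix f y"
  define Z where "Z = pinv M H"
  have "f j y + gradient (f j) y \<bullet> (x - y)
      \<le> f j x - column j H \<bullet> column j Z + 1/2 * (column j (M Z) \<bullet> column j Z)" for j
  proof -
    let ?z = "column j Z"
    have "f j y + gradient (f j) y \<bullet> (x - ?z - y) \<le> f j (x - ?z)"
      by (rule convex_above_tangent[OF conv GDERIV_gradient[OF diff]])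
    also have "\<dots> \<le> f j x + gradient (f j) x \<bullet> (x - ?z - x) + 1/2 * sqnorm (A j) (x - ?z - x)"
      using smooth[of j] unfolding smooth_wrt_def by blast
    also have "sqnorm (A j) (x - ?z - x) = column j (M Z) \<bullet> ?z"
      by (simp add: sqnorm_def M_def column_columnwise_op linear_neg[OF matrix_vector_mul_linear])
    finally show ?thesis
      by (simp add: H_def column_diff column_grad_matrix algebra_simps inner_diff_left inner_diff_right)
  qed
  then have "(\<Sum>j\<in>UNIV. f j y + gradient (f j) y \<bullet> (x - y))
      \<le> (\<Sum>j\<in>UNIV. f j x - column j H \<bullet> column j Z + 1/2 * (column j (M Z) \<bullet> column j Z))"
    by (intro sum_mono)
  also have "\<dots> = (\<Sum>j\<in>UNIV. f j x) - H \<bullet> Z + 1/2 * (M Z \<bullet> Z)"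
    unfolding inner_columns by (simp add: sum.distrib sum_subtractf sum_distrib_left)
  also have "M Z \<bullet> Z = Z \<bullet> H"
  proof -
    have "selfadjoint (pinv M)" "pinv M (M (pinv M H)) = pinv M H"
      using psd_pinv[OF M] by (auto simp: psd_op_def is_pinv_def fun_eq_iff)
    then show ?thesis
      unfolding Z_def by (metis selfadjoint_inner)
  qed
  also have "H \<bullet> Z = (norm (psd_sqrt (pinv M) H))\<^sup>2"
    using norm_psd_sqrt[OF psd_pinv(2)[OF M]] by (simp add: Z_def inner_commute)
  also have "Z \<bullet> H = (norm (psd_sqrt (pinv M) H))\<^sup>2"
    using norm_psd_sqrt[OF psd_pinv(2)[OF M]] by (simp add: Z_def)
  finally show ?thesis
    by (simp add: M_def H_def)
qed

text \<open>Strong convexity bounds \<open>average f y\<close> from below at \<open>x\<close> and cocoercivity bounds \<open>average f x\<close> from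
  below at \<open>y\<close>; in the sum the function values cancel.\<close>

lemma gradient_monotonicity:
  fixes f :: "'n::finite \<Rightarrow> real^'d::finite \<Rightarrow> real"
  assumes psd: "\<And>j. psd_matrix (A j)" and conv: "\<And>j. convex_on UNIV (f j)"
    and diff: "\<And>j x. f j differentiable (at x)" and smooth: "\<And>j. smooth_wrt (A j) (f j)"
    and strong: "strongly_convex_over \<sigma> L (average f)" and "x \<in> L" "y \<in> L"
  shows "\<sigma> / 2 * (norm (x - y))\<^sup>2 + 1 / (2 * real CARD('n))
      * (norm (psd_sqrt (pinv (columnwise_op A)) (grad_matrix f x - grad_matrix f y)))\<^sup>2
    \<le> (x - y) \<bullet> ((1 / real CARD('n)) *\<^sub>R ((grad_matrix f x - grad_matrix f y) *v vec 1))"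
proof -
  let ?n = "real CARD('n)"
  let ?N = "(norm (psd_sqrt (pinv (columnwise_op A)) (grad_matrix f x - grad_matrix f y)))\<^sup>2"
  let ?g = "gradient (average f)"
  have g: "?g z = (1 / ?n) *\<^sub>R (\<Sum>j\<in>UNIV. gradient (f j) z)" for z
    unfolding gradient_average(2)[OF diff]
    by (simp add: vec_eq_iff grad_matrix_def matrix_vector_mult_def)
  have "1 / ?n * ((\<Sum>j\<in>UNIV. f j y + gradient (f j) y \<bullet> (x - y)) + 1/2 * ?N)
      \<le> 1 / ?n * (\<Sum>j\<in>UNIV. f j x)"
    using cocoercivity[of A f y x, OF psd conv diff smooth] by (intro mult_left_mono) auto
  then have "average f y + ?g y \<bullet> (x - y) + 1 / (2 * ?n) * ?N \<le> average f x"
    by (simp add: average_def g sum.distrib inner_sum_left add_divide_distrib)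
  moreover have "average f x + ?g x \<bullet> (y - x) + \<sigma> / 2 * (norm (y - x))\<^sup>2 \<le> average f y"
    using strong \<open>x \<in> L\<close> \<open>y \<in> L\<close> unfolding strongly_convex_over_def by blast
  moreover have "(x - y) \<bullet> ((1 / ?n) *\<^sub>R ((grad_matrix f x - grad_matrix f y) *v vec 1))
      = (x - y) \<bullet> (?g x - ?g y)"
    by (simp add: gradient_average(2)[OF diff] matrix_vector_mult_diff_rdistrib scaleR_diff_right)
  moreover have "(x - y) \<bullet> (?g x - ?g y) = - (?g x \<bullet> (y - x)) - ?g y \<bullet> (x - y)"
    by (simp add: inner_diff_left inner_diff_right inner_commute)
  ultimately show ?thesis
    by (simp add: norm_minus_commute)
qed

section \<open>Random operators\<close>

lemma orth_projection_norms:
  assumes "orth_projection T"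
  shows "(norm (T x))\<^sup>2 = T x \<bullet> x" and "(norm (x - T x))\<^sup>2 = (x - T x) \<bullet> x"
    and "norm (T x) \<le> norm x"
    and "(norm (x - T x + T y))\<^sup>2 = (norm (x - T x))\<^sup>2 + (norm (T y))\<^sup>2"
proof -
  have T: "T u \<bullet> v = u \<bullet> T v" "T (T u) = T u" for u v
    using assms by (auto simp: orth_projection_def selfadjoint_def fun_eq_iff)
  have 0: "(u - T u) \<bullet> T v = 0" for u v
    using T(1)[of "u" "T v"] by (simp add: inner_diff_left T)
  show 1: "(norm (T x))\<^sup>2 = T x \<bullet> x"
    by (simp add: power2_norm_eq_inner T)
  show "(norm (x - T x))\<^sup>2 = (x - T x) \<bullet> x"
    using 0[of x x] by (simp add: power2_norm_eq_inner inner_diff_right)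
  have "norm (T x) * norm (T x) \<le> norm (T x) * norm x"
    using 1 norm_cauchy_schwarz[of "T x" x] by (simp add: power2_eq_square)
  then show "norm (T x) \<le> norm x"
    by (cases "norm (T x) = 0") (auto simp: mult_le_cancel_left)
  show "(norm (x - T x + T y))\<^sup>2 = (norm (x - T x))\<^sup>2 + (norm (T y))\<^sup>2"
    using 0[of x y] by (simp add: power2_norm_eq_inner inner_add_left inner_add_right inner_commute)
qed

locale random_projection = prob_space D for D :: "'s measure" +
  fixes S :: "'s \<Rightarrow> 'a::euclidean_space \<Rightarrow>\<^sub>L 'a"
  assumes S_measurable: "\<And>x. (\<lambda>w. blinfun_apply (S w) x) \<in> borel_measurable D"
    and S_projection: "\<And>w. w \<in> space D \<Longrightarrow> orth_projection (blinfun_apply (S w))"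
begin

lemma S_integrable: "integrable D (\<lambda>w. blinfun_apply (S w) x)"
  by (rule integrable_const_bound[where B = "norm x"])
    (use S_measurable orth_projection_norms(3)[OF S_projection] in \<open>auto intro!: AE_I2\<close>)

lemma linear_mean: "linear (op_expectation D S)"
  by (rule linearI)
    (simp_all add: op_expectation_def blinfun.add_right blinfun.scaleR_right S_integrable)

lemma mean_inner: "op_expectation D S x \<bullet> y = expectation (\<lambda>w. blinfun_apply (S w) x \<bullet> y)"
  by (simp add: op_expectation_def S_integrable)

lemma selfadjoint_mean: "selfadjoint (op_expectation D S)"
proof -
  have "op_expectation D S x \<bullet> y = x \<bullet> op_expectation D S y" for x y
    unfolding inner_commute[of x] mean_inner using S_projection
    by (intro Bochner_Integration.integral_cong)
      (auto simp: orth_projection_def selfadjoint_def inner_commute)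
  then show ?thesis by (simp add: selfadjoint_def linear_mean)
qed

lemma norm_square_integrable:
  "integrable D (\<lambda>w. (norm (blinfun_apply (S w) x))\<^sup>2)"
  "integrable D (\<lambda>w. (norm (x - blinfun_apply (S w) x))\<^sup>2)"
proof -
  have "integrable D (\<lambda>w. blinfun_apply (S w) x \<bullet> x)"
       "integrable D (\<lambda>w. (x - blinfun_apply (S w) x) \<bullet> x)"
    by (simp_all add: S_integrable inner_diff_left)
  then show "integrable D (\<lambda>w. (norm (blinfun_apply (S w) x))\<^sup>2)"
    "integrable D (\<lambda>w. (norm (x - blinfun_apply (S w) x))\<^sup>2)"
    by (simp_all add: orth_projection_norms(1,2)[OF S_projection] cong: Bochner_Integration.integrable_cong)
qed

lemma mean_norm_square_inner:
  "expectation (\<lambda>w. (norm (blinfun_apply (S w) x))\<^sup>2) = op_expectation D S x \<bullet> x"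
  "expectation (\<lambda>w. (norm (x - blinfun_apply (S w) x))\<^sup>2) = (x - op_expectation D S x) \<bullet> x"
proof -
  show "expectation (\<lambda>w. (norm (blinfun_apply (S w) x))\<^sup>2) = op_expectation D S x \<bullet> x"
    unfolding mean_inner
    by (intro Bochner_Integration.integral_cong) (simp_all add: orth_projection_norms(1)[OF S_projection])
  have "expectation (\<lambda>w. (norm (x - blinfun_apply (S w) x))\<^sup>2)
      = expectation (\<lambda>w. (x - blinfun_apply (S w) x) \<bullet> x)"
    by (intro Bochner_Integration.integral_cong) (simp_all add: orth_projection_norms(2)[OF S_projection])
  also have "\<dots> = x \<bullet> x - expectation (\<lambda>w. blinfun_apply (S w) x \<bullet> x)"
    by (simp add: inner_diff_left S_integrable prob_space)
  finally show "expectation (\<lambda>w. (norm (x - blinfun_apply (S w) x))\<^sup>2)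
      = (x - op_expectation D S x) \<bullet> x"
    by (simp add: inner_diff_left mean_inner)
qed

text \<open>The squared norm of a projection of \<open>x\<close> is linear in the projection, so it commutes with the
  expectation and becomes a quadratic form of the mean operator.\<close>

lemma mean_norm_square:
  "expectation (\<lambda>w. (norm (blinfun_apply (S w) x))\<^sup>2)
     = (norm (psd_sqrt (op_expectation D S) x))\<^sup>2"
  "expectation (\<lambda>w. (norm (x - blinfun_apply (S w) x))\<^sup>2)
     = (norm (psd_sqrt (\<lambda>y. y - op_expectation D S y) x))\<^sup>2"
proof -
  have pos: "0 \<le> op_expectation D S y \<bullet> y" "0 \<le> (y - op_expectation D S y) \<bullet> y" for y
    unfolding mean_norm_square_inner[symmetric] by (rule Bochner_Integration.integral_nonneg; simp)+
  have "psd_op (op_expectation D S)"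
    using pos(1) selfadjoint_mean by (simp add: psd_op_def)
  moreover have "linear (\<lambda>y. y - op_expectation D S y)"
    using linear_compose_sub[OF linear_id linear_mean] by simp
  then have "psd_op (\<lambda>y. y - op_expectation D S y)"
    using pos(2) selfadjoint_mean
    by (auto simp: psd_op_def selfadjoint_def inner_diff_left inner_diff_right)
  ultimately show
    "expectation (\<lambda>w. (norm (blinfun_apply (S w) x))\<^sup>2)
       = (norm (psd_sqrt (op_expectation D S) x))\<^sup>2"
    "expectation (\<lambda>w. (norm (x - blinfun_apply (S w) x))\<^sup>2)
       = (norm (psd_sqrt (\<lambda>y. y - op_expectation D S y) x))\<^sup>2"
    by (simp_all add: norm_psd_sqrt mean_norm_square_inner)
qed

end

section \<open>The expected decrease in one step\<close>

lemma sqnorm_nonneg: "projection_matrix W \<Longrightarrow> 0 \<le> sqnorm W v"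
  by (metis norm_W_square zero_le_power2)

lemma sqnorm_scaleR: "sqnorm W (c *\<^sub>R v) = c\<^sup>2 * sqnorm W v"
  by (simp add: sqnorm_def linear_scale[OF matrix_vector_mul_linear] power2_eq_square)

lemma sqnorm_diff:
  assumes "projection_matrix W"
  shows "sqnorm W (u - v) = sqnorm W u - 2 * ((W *v u) \<bullet> v) + sqnorm W v"
proof -
  have "(W *v v) \<bullet> u = (W *v u) \<bullet> v"
    using assms by (metis dot_lmul_matrix inner_commute projection_matrix_def vector_transpose_matrix)
  then show ?thesis
    by (simp add: sqnorm_def matrix_vector_mult_diff_distrib inner_diff_left inner_diff_right)
qed

lemma sqnorm_add_le:
  assumes "projection_matrix W"
  shows "sqnorm W (u + v) \<le> 2 * sqnorm W u + 2 * sqnorm W v"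
  using sqnorm_nonneg[OF assms, of "u - v"] sqnorm_diff[OF assms, of u v]
    sqnorm_diff[OF assms, of u "- v"]
  by (simp add: sqnorm_def linear_neg[OF matrix_vector_mul_linear])

lemma affine_range_diff:
  assumes "projection_matrix W" "x \<in> affine_range x0 W" "y \<in> affine_range x0 W"
  shows "W *v (x - y) = x - y"
proof -
  obtain u v where "x = x0 + W *v u" "y = x0 + W *v v"
    using assms by (auto simp: affine_range_def)
  then have "x - y = W *v (u - v)" by (simp add: matrix_vector_mult_diff_distrib)
  then show ?thesis
    using assms(1) by (simp add: projection_matrix_def matrix_vector_mul_assoc)
qed

text \<open>Separating the state from the pair of operators makes their independence usable.\<close>

definition gjs_step ::
    "('n::finite \<Rightarrow> real^'d \<Rightarrow> real) \<Rightarrow> (real^'d \<Rightarrow> ereal) \<Rightarrow> real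
       \<Rightarrow> ((real^'d) \<times> (real^'n^'d)) \<Rightarrow> (('d::finite, 'n) matrix_op \<times> ('d, 'n) matrix_op)
       \<Rightarrow> (real^'d) \<times> (real^'n^'d)" where
  "gjs_step f \<psi> \<alpha> = (\<lambda>(x, J) (S, U).
     (prox \<alpha> \<psi> (x - \<alpha> *\<^sub>R gjs_estimator f U x J), J - blinfun_apply S (J - grad_matrix f x)))"

lemma gjs_Suc:
  "gjs f \<psi> \<alpha> x0 J0 S U (Suc k) = gjs_step f \<psi> \<alpha> (gjs f \<psi> \<alpha> x0 J0 S U k) (S k, U k)"
  by (simp add: gjs_step_def case_prod_beta Let_def)

locale gjs_assumptions = random_projection D S
  for D :: "'s measure" and S :: "'s \<Rightarrow> ('d::finite, 'n::finite) matrix_op" +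
  fixes U :: "'s \<Rightarrow> ('d, 'n) matrix_op"
    and f :: "'n \<Rightarrow> real^'d \<Rightarrow> real" and A :: "'n \<Rightarrow> real^'d^'d"
    and \<psi> :: "real^'d \<Rightarrow> ereal" and xs x0 :: "real^'d" and W :: "real^'d^'d"
    and \<sigma> \<alpha> :: real and B :: "real^'n^'d \<Rightarrow> real^'n^'d"
    and Mdh :: "real^'n^'d \<Rightarrow> real^'n^'d"
  assumes Mdh_def: "Mdh = psd_sqrt (pinv (columnwise_op A))"
    and psd: "\<And>j. psd_matrix (A j)"
    and convex: "\<And>j. convex_on UNIV (f j)"
    and diff: "\<And>j x. f j differentiable (at x)"
    and smooth: "\<And>j. smooth_wrt (A j) (f j)"
    and psi: "ereal_convex \<psi>"
    and minimizer: "is_arg_min (\<lambda>x. ereal (average f x) + \<psi> x) (\<lambda>_. True) xs"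
    and W: "projection_matrix W"
    and psi_off: "\<And>x. x \<notin> affine_range x0 W \<Longrightarrow> \<psi> x = \<infinity>"
    and strong: "strongly_convex_over \<sigma> (affine_range x0 W) (average f)"
    and alpha: "\<alpha> > 0"
    and prox: "prox_well_defined \<alpha> \<psi>"
    and U_integrable: "\<And>X. integrable D (\<lambda>w. blinfun_apply (U w) X)"
    and U_mean: "op_expectation D U = id"
    and M_commutes: "\<And>w. w \<in> space D \<Longrightarrow> Mdh \<circ> blinfun_apply (S w) = blinfun_apply (S w) \<circ> Mdh"
    and B_linear: "linear B"
    and B_commutes: "\<And>w. w \<in> space D \<Longrightarrow> B \<circ> blinfun_apply (S w) = blinfun_apply (S w) \<circ> B"
    and U_sq_integrable:
      "\<And>X. integrable D (\<lambda>w. sqnorm W (blinfun_apply (U w) X *v vec 1))"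
    and ineq1: "\<And>X. 2 * \<alpha> / (real CARD('n))\<^sup>2
                     * integral\<^sup>L D (\<lambda>w. sqnorm W (blinfun_apply (U w) X *v vec 1))
                   + (norm (psd_sqrt (\<lambda>Y. Y - op_expectation D S Y) (B (Mdh X))))\<^sup>2
                   \<le> (1 - \<alpha> * \<sigma>) * (norm (B (Mdh X)))\<^sup>2"
    and ineq2: "\<And>X. 2 * \<alpha> / (real CARD('n))\<^sup>2
                     * integral\<^sup>L D (\<lambda>w. sqnorm W (blinfun_apply (U w) X *v vec 1))
                   + (norm (psd_sqrt (op_expectation D S) (B (Mdh X))))\<^sup>2
                   \<le> 1 / real CARD('n) * (norm (Mdh X))\<^sup>2"
begin

abbreviation "G \<equiv> grad_matrix f"
abbreviation "\<Psi> \<equiv> gjs_lyapunov A B f \<alpha> xs"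
abbreviation "q X \<equiv> expectation (\<lambda>w. sqnorm W (blinfun_apply (U w) X *v vec 1))"

lemma linear_Mdh: "linear Mdh"
  using psd_sqrt(1)[OF psd_pinv(2)[OF psd_columnwise_op[of A, OF psd]]]
  by (simp add: Mdh_def psd_op_def selfadjoint_def)

lemma linear_BM: "linear (\<lambda>X. B (Mdh X))"
  using linear_compose[OF linear_Mdh B_linear] by (simp add: comp_def)

lemma BM_commutes: "w \<in> space D \<Longrightarrow> B (Mdh (blinfun_apply (S w) X)) = blinfun_apply (S w) (B (Mdh X))"
  using M_commutes B_commutes by (simp add: fun_eq_iff)

lemma lyapunov_eq: "\<Psi> (x, J) = (norm (x - xs))\<^sup>2 + \<alpha> * (norm (B (Mdh (J - G xs))))\<^sup>2"
  by (simp add: gjs_lyapunov_def Mdh_def)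

lemma lyapunov_nonneg: "0 \<le> \<Psi> s"
  using alpha by (cases s) (simp add: lyapunov_eq)

lemma xs_in: "xs \<in> affine_range x0 W"
  using minimizer_finite[OF prox alpha psi minimizer] psi_off by (metis PInfty_neq_ereal(1))

lemma U_sum_integrable: "integrable D (\<lambda>w. blinfun_apply (U w) X *v vec 1)"
  and U_sum_mean: "expectation (\<lambda>w. blinfun_apply (U w) X *v vec 1) = X *v vec 1"
proof -
  have bl: "bounded_linear (\<lambda>X :: real^'n^'d. X *v vec 1)"
    unfolding linear_conv_bounded_linear[symmetric]
    by (rule linearI) (simp_all add: matrix_vector_mult_add_rdistrib scaleR_matrix_vector_assoc)
  show "integrable D (\<lambda>w. blinfun_apply (U w) X *v vec 1)"
    using integrable_bounded_linear[OF bl U_integrable] .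
  have "expectation (\<lambda>w. blinfun_apply (U w) X) = X"
    using fun_cong[OF U_mean, of X] by (simp add: op_expectation_def)
  then show "expectation (\<lambda>w. blinfun_apply (U w) X *v vec 1) = X *v vec 1"
    using integral_bounded_linear[OF bl U_integrable, of X] by simp
qed

text \<open>The estimator error splits into a part that only involves the memory error \<open>Y\<close> and one that only
  involves the gradient difference \<open>H\<close>. The former is a centred variable, so its second moment is at
  most that of \<open>U Y\<close>.\<close>

lemma primal_step:
  fixes J
  assumes x: "x \<in> affine_range x0 W"
  defines "Y \<equiv> J - G xs" and "H \<equiv> G x - G xs"
  obtains R where "integrable D R"
    and "\<And>w. (norm (prox \<alpha> \<psi> (x - \<alpha> *\<^sub>R gjs_estimator f (U w) x J) - xs))\<^sup>2 \<le> R w"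
    and "expectation R \<le> (norm (x - xs))\<^sup>2 - 2 * \<alpha> * ((x - xs) \<bullet> ((1 / real CARD('n)) *\<^sub>R (H *v vec 1)))
           + \<alpha>\<^sup>2 * (2 / (real CARD('n))\<^sup>2) * (q Y + q H)"
proof -
  let ?e = "vec 1 :: real^'n"
  define u where "u w X = blinfun_apply (U w) X *v ?e" for w X
  note ui = U_sum_integrable[folded u_def] and um = U_sum_mean[folded u_def]
    and us = U_sq_integrable[folded u_def]
  define d where "d w = (1 / real CARD('n)) *\<^sub>R ((Y *v ?e - u w Y) + u w H)" for w
  define R where "R w = (norm (x - xs))\<^sup>2 - 2 * \<alpha> * ((x - xs) \<bullet> d w)
      + \<alpha>\<^sup>2 * (2 / (real CARD('n))\<^sup>2) * ((sqnorm W (Y *v ?e) - 2 * ((W *v (Y *v ?e)) \<bullet> u w Y) + sqnorm W (u w Y))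
          + sqnorm W (u w H))" for w
  have di: "integrable D d"
    unfolding d_def by (simp add: ui)
  have dm: "expectation d = (1 / real CARD('n)) *\<^sub>R (H *v ?e)"
    unfolding d_def by (simp add: ui um prob_space)
  have fixpt: "prox \<alpha> \<psi> (xs - \<alpha> *\<^sub>R ((1 / real CARD('n)) *\<^sub>R (G xs *v ?e))) = xs"
    by (rule minimizer_fixed_point[OF prox alpha psi minimizer gradient_average(1)[OF diff]])
  have est: "gjs_estimator f (U w) x J = (1 / real CARD('n)) *\<^sub>R (G xs *v ?e) + d w" for w
  proof -
    have "G x - J = H - Y" by (simp add: H_def Y_def)
    then have "blinfun_apply (U w) (G x - J) *v ?e = u w H - u w Y"
      by (simp add: u_def blinfun.diff_right matrix_vector_mult_diff_rdistrib)
    moreover have "J *v ?e = G xs *v ?e + Y *v ?e"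
      by (simp add: Y_def matrix_vector_mult_diff_rdistrib)
    ultimately show ?thesis
      unfolding gjs_estimator_def d_def scaleR_add_right[symmetric]
      by (simp only:) (simp add: algebra_simps)
  qed
  have bound: "(norm (prox \<alpha> \<psi> (x - \<alpha> *\<^sub>R gjs_estimator f (U w) x J) - xs))\<^sup>2 \<le> R w" for w
  proof -
    have "(norm (prox \<alpha> \<psi> (x - \<alpha> *\<^sub>R gjs_estimator f (U w) x J) - xs))\<^sup>2
        \<le> sqnorm W ((x - \<alpha> *\<^sub>R gjs_estimator f (U w) x J)
            - (xs - \<alpha> *\<^sub>R ((1 / real CARD('n)) *\<^sub>R (G xs *v ?e))))"
      using prox_contraction_W(2)[where ?x0.0 = x0 and u = "x - \<alpha> *\<^sub>R gjs_estimator f (U w) x J"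
          and v = "xs - \<alpha> *\<^sub>R ((1 / real CARD('n)) *\<^sub>R (G xs *v ?e))",
          OF prox alpha psi W psi_off]
      unfolding fixpt .
    also have "\<dots> = sqnorm W ((x - xs) - \<alpha> *\<^sub>R d w)"
      unfolding est by (simp add: algebra_simps)
    also have "\<dots> = (norm (x - xs))\<^sup>2 - 2 * \<alpha> * ((x - xs) \<bullet> d w) + \<alpha>\<^sup>2 * sqnorm W (d w)"
      unfolding sqnorm_diff[OF W, of "x - xs" "\<alpha> *\<^sub>R d w"] sqnorm_scaleR
      by (simp add: sqnorm_def affine_range_diff[OF W x xs_in] power2_norm_eq_inner)
    also have "\<dots> \<le> (norm (x - xs))\<^sup>2 - 2 * \<alpha> * ((x - xs) \<bullet> d w)
        + \<alpha>\<^sup>2 * (1 / (real CARD('n))\<^sup>2 * (2 * sqnorm W (Y *v ?e - u w Y) + 2 * sqnorm W (u w H)))"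
      unfolding d_def sqnorm_scaleR power_divide power_one
      by (intro add_left_mono mult_left_mono sqnorm_add_le[OF W]) auto
    also have "\<dots> = R w"
      unfolding R_def sqnorm_diff[OF W, symmetric] by (simp add: algebra_simps add_divide_distrib)
    finally show ?thesis .
  qed
  have Ri: "integrable D R"
    unfolding R_def by (simp add: ui us di)
  have "expectation R = (norm (x - xs))\<^sup>2 - 2 * \<alpha> * ((x - xs) \<bullet> ((1 / real CARD('n)) *\<^sub>R (H *v ?e)))
      + \<alpha>\<^sup>2 * (2 / (real CARD('n))\<^sup>2) * ((sqnorm W (Y *v ?e) - 2 * ((W *v (Y *v ?e)) \<bullet> (Y *v ?e)) + q Y) + q H)"
    unfolding R_def by (simp add: ui us di dm um prob_space) (simp add: u_def)
  also have "\<dots> \<le> (norm (x - xs))\<^sup>2 - 2 * \<alpha> * ((x - xs) \<bullet> ((1 / real CARD('n)) *\<^sub>R (H *v ?e)))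
           + \<alpha>\<^sup>2 * (2 / (real CARD('n))\<^sup>2) * (q Y + q H)"
    using sqnorm_nonneg[OF W, of "Y *v ?e"]
    by (intro add_left_mono mult_left_mono) (auto simp: sqnorm_def)
  finally show ?thesis
    by (rule that[OF Ri bound])
qed

text \<open>The new memory error has one part in the kernel of the projection \<open>S w\<close> and one in its range, and
  commutation carries this orthogonality over to the images under \<open>B \<circ> Mdh\<close>.\<close>

lemma memory_step:
  assumes "w \<in> space D"
  shows "(norm (B (Mdh (J - blinfun_apply (S w) (J - G x) - G xs))))\<^sup>2
    = (norm (B (Mdh (J - G xs)) - blinfun_apply (S w) (B (Mdh (J - G xs)))))\<^sup>2
      + (norm (blinfun_apply (S w) (B (Mdh (G x - G xs)))))\<^sup>2"
proof -
  have eq: "J - blinfun_apply (S w) (J - G x) - G xs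
      = (J - G xs) - blinfun_apply (S w) (J - G xs) + blinfun_apply (S w) (G x - G xs)"
    by (simp add: blinfun.diff_right)
  show ?thesis
    unfolding eq linear_add[OF linear_BM] linear_diff[OF linear_BM, of "J - G xs"] BM_commutes[OF assms]
    by (rule orth_projection_norms(4)[OF S_projection[OF assms]])
qed

text \<open>The second moments of the operator parts are absorbed by the two hypotheses, applied to the memory
  error and to the gradient difference. What remains of the latter is \<open>\<alpha> / n\<close> times the squared norm of
  its \<open>Mdh\<close>-image, exactly what the inner product with the gradient gives back.\<close>

lemma one_step:
  assumes x: "x \<in> affine_range x0 W"
  obtains R where "integrable D R" "\<And>w. w \<in> space D \<Longrightarrow> \<Psi> (gjs_step f \<psi> \<alpha> (x, J) (S w, U w)) \<le> R w"
    and "expectation R \<le> (1 - \<alpha> * \<sigma>) * \<Psi> (x, J)"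
proof -
  let ?e = "vec 1 :: real^'n"
  define Y where "Y = J - G xs"
  define H where "H = G x - G xs"
  obtain R1 where R1: "integrable D R1"
    "\<And>w. (norm (prox \<alpha> \<psi> (x - \<alpha> *\<^sub>R gjs_estimator f (U w) x J) - xs))\<^sup>2 \<le> R1 w"
    "expectation R1 \<le> (norm (x - xs))\<^sup>2 - 2 * \<alpha> * ((x - xs) \<bullet> ((1 / real CARD('n)) *\<^sub>R (H *v ?e)))
           + \<alpha>\<^sup>2 * (2 / (real CARD('n))\<^sup>2) * (q Y + q H)"
    using primal_step[OF x, of J] unfolding Y_def H_def by blast
  define R2 where "R2 w = (norm (B (Mdh Y) - blinfun_apply (S w) (B (Mdh Y))))\<^sup>2
      + (norm (blinfun_apply (S w) (B (Mdh H))))\<^sup>2" for w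
  have R2: "integrable D R2"
    unfolding R2_def by (simp add: norm_square_integrable)
  have "expectation R2 = (norm (psd_sqrt (\<lambda>Y. Y - op_expectation D S Y) (B (Mdh Y))))\<^sup>2
      + (norm (psd_sqrt (op_expectation D S) (B (Mdh H))))\<^sup>2" (is "_ = ?a + ?b")
    unfolding R2_def by (simp add: norm_square_integrable mean_norm_square)
  then have "expectation (\<lambda>w. R1 w + \<alpha> * R2 w)
      \<le> (norm (x - xs))\<^sup>2 - 2 * \<alpha> * ((x - xs) \<bullet> ((1 / real CARD('n)) *\<^sub>R (H *v ?e)))
           + \<alpha>\<^sup>2 * (2 / (real CARD('n))\<^sup>2) * (q Y + q H) + \<alpha> * (?a + ?b)"
    using R1(1,3) R2 by simp
  also have "\<dots> = (norm (x - xs))\<^sup>2 - 2 * \<alpha> * ((x - xs) \<bullet> ((1 / real CARD('n)) *\<^sub>R (H *v ?e)))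
      + \<alpha> * (2 * \<alpha> / (real CARD('n))\<^sup>2 * q Y + ?a) + \<alpha> * (2 * \<alpha> / (real CARD('n))\<^sup>2 * q H + ?b)"
    by (simp add: algebra_simps power2_eq_square)
  also have "\<dots> \<le> (norm (x - xs))\<^sup>2 - 2 * \<alpha> * ((x - xs) \<bullet> ((1 / real CARD('n)) *\<^sub>R (H *v ?e)))
      + \<alpha> * ((1 - \<alpha> * \<sigma>) * (norm (B (Mdh Y)))\<^sup>2) + \<alpha> * (1 / real CARD('n) * (norm (Mdh H))\<^sup>2)"
    using ineq1[of Y] ineq2[of H] alpha by (intro add_mono mult_left_mono order.refl) auto
  also have "\<dots> \<le> (1 - \<alpha> * \<sigma>) * \<Psi> (x, J)"
  proof -
    have "\<sigma> / 2 * (norm (x - xs))\<^sup>2 + 1 / (2 * real CARD('n)) * (norm (Mdh H))\<^sup>2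
        \<le> (x - xs) \<bullet> ((1 / real CARD('n)) *\<^sub>R (H *v ?e))"
      unfolding H_def Mdh_def
      by (rule gradient_monotonicity[OF psd convex diff smooth strong x xs_in])
    then have "2 * \<alpha> * (\<sigma> / 2 * (norm (x - xs))\<^sup>2 + 1 / (2 * real CARD('n)) * (norm (Mdh H))\<^sup>2)
        \<le> 2 * \<alpha> * ((x - xs) \<bullet> ((1 / real CARD('n)) *\<^sub>R (H *v ?e)))"
      using alpha by (intro mult_left_mono) auto
    moreover have "2 * \<alpha> * (\<sigma> / 2 * (norm (x - xs))\<^sup>2 + 1 / (2 * real CARD('n)) * (norm (Mdh H))\<^sup>2)
        = \<alpha> * \<sigma> * (norm (x - xs))\<^sup>2 + \<alpha> * (1 / real CARD('n) * (norm (Mdh H))\<^sup>2)"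
      by (simp add: field_simps)
    moreover have "(1 - \<alpha> * \<sigma>) * \<Psi> (x, J) = (norm (x - xs))\<^sup>2 - \<alpha> * \<sigma> * (norm (x - xs))\<^sup>2
        + \<alpha> * ((1 - \<alpha> * \<sigma>) * (norm (B (Mdh Y)))\<^sup>2)"
      by (simp add: lyapunov_eq Y_def algebra_simps)
    ultimately show ?thesis by linarith
  qed
  finally have "expectation (\<lambda>w. R1 w + \<alpha> * R2 w) \<le> (1 - \<alpha> * \<sigma>) * \<Psi> (x, J)" .
  moreover have "\<Psi> (gjs_step f \<psi> \<alpha> (x, J) (S w, U w)) \<le> R1 w + \<alpha> * R2 w" if "w \<in> space D" for w
    using R1(2)[of w] memory_step[OF that, of J x] by (simp add: gjs_step_def lyapunov_eq R2_def Y_def H_def)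
  moreover have "integrable D (\<lambda>w. R1 w + \<alpha> * R2 w)"
    using R1(1) R2 by simp
  ultimately show ?thesis using that by blast
qed

lemma one_step_nn_integral:
  assumes x: "fst s \<in> affine_range x0 W"
  shows "(\<integral>\<^sup>+w. ennreal (\<Psi> (gjs_step f \<psi> \<alpha> s (S w, U w))) \<partial>D) \<le> ennreal ((1 - \<alpha> * \<sigma>) * \<Psi> s)"
    and "0 \<le> (1 - \<alpha> * \<sigma>) * \<Psi> s"
proof -
  obtain R where R: "integrable D R"
    "\<And>w. w \<in> space D \<Longrightarrow> \<Psi> (gjs_step f \<psi> \<alpha> s (S w, U w)) \<le> R w"
    "expectation R \<le> (1 - \<alpha> * \<sigma>) * \<Psi> s"
    using one_step[of "fst s" "snd s"] x by auto
  have nn: "0 \<le> R w" if "w \<in> space D" for w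
    using R(2)[OF that] lyapunov_nonneg by (rule order_trans[rotated])
  have "(\<integral>\<^sup>+w. ennreal (\<Psi> (gjs_step f \<psi> \<alpha> s (S w, U w))) \<partial>D) \<le> (\<integral>\<^sup>+w. ennreal (R w) \<partial>D)"
    using R(2) by (intro nn_integral_mono ennreal_leI) auto
  also have "\<dots> = ennreal (expectation R)"
    using R(1) nn by (intro nn_integral_eq_integral) (auto intro!: AE_I2)
  also have "\<dots> \<le> ennreal ((1 - \<alpha> * \<sigma>) * \<Psi> s)"
    using R(3) by (rule ennreal_leI)
  finally show "(\<integral>\<^sup>+w. ennreal (\<Psi> (gjs_step f \<psi> \<alpha> s (S w, U w))) \<partial>D) \<le> ennreal ((1 - \<alpha> * \<sigma>) * \<Psi> s)" .
  have "0 \<le> expectation R"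
    using nn by (intro Bochner_Integration.integral_nonneg_AE AE_I2) auto
  then show "0 \<le> (1 - \<alpha> * \<sigma>) * \<Psi> s" using R(3) by linarith
qed

end

section \<open>Measurability of the iteration\<close>

text \<open>Expanding the argument in the basis leaves evaluations at fixed vectors, which are continuous in
  the operator. This gives joint measurability for the product \<open>\<sigma>\<close>-algebra without second
  countability of the operator space.\<close>

lemma measurable_blinfun_apply_at:
  fixes F :: "'m \<Rightarrow> ('a::euclidean_space \<Rightarrow>\<^sub>L 'b::euclidean_space)"
  assumes F: "F \<in> measurable M borel" and g: "g \<in> borel_measurable M"
  shows "(\<lambda>w. blinfun_apply (F w) (g w)) \<in> borel_measurable M"
proof -
  have c: "(\<lambda>w. blinfun_apply (F w) b) \<in> borel_measurable M" for b
  proof (rule measurable_compose[OF F])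
    show "(\<lambda>T. blinfun_apply T b) \<in> borel_measurable borel"
      by (intro borel_measurable_continuous_onI continuous_intros)
  qed
  have "blinfun_apply (F w) (g w) = (\<Sum>b\<in>Basis. (g w \<bullet> b) *\<^sub>R blinfun_apply (F w) b)" for w
  proof -
    have "blinfun_apply (F w) (g w) = blinfun_apply (F w) (\<Sum>b\<in>Basis. (g w \<bullet> b) *\<^sub>R b)"
      by (simp add: euclidean_representation)
    also have "\<dots> = (\<Sum>b\<in>Basis. (g w \<bullet> b) *\<^sub>R blinfun_apply (F w) b)"
      by (simp add: blinfun.sum_right blinfun.scaleR_right)
    finally show ?thesis .
  qed
  then show ?thesis using g c by simp
qed

text \<open>The gradient is a pointwise limit of difference quotients.\<close>

lemma borel_measurable_gradient:
  fixes f :: "'a::euclidean_space \<Rightarrow> real"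
  assumes "\<And>x. f differentiable (at x)"
  shows "gradient f \<in> borel_measurable borel"
proof -
  have cont: "continuous_on UNIV f"
    using assms by (simp add: continuous_on_eq_continuous_at differentiable_imp_continuous_within)
  then have f: "f \<in> borel_measurable borel"
    by (rule borel_measurable_continuous_onI)
  have "(\<lambda>x. gradient f x \<bullet> b) \<in> borel_measurable borel" for b
  proof (rule borel_measurable_LIMSEQ_real)
    fix x
    have "filterlim (\<lambda>k. inverse (real (Suc k))) (at 0) sequentially"
      unfolding filterlim_at using LIMSEQ_inverse_real_of_nat by auto
    from filterlim_compose[OF GDERIV_line[OF GDERIV_gradient[OF assms]] this]
    show "(\<lambda>k. (f (x + inverse (real (Suc k)) *\<^sub>R b) - f x) / inverse (real (Suc k)))
        \<longlonglongrightarrow> gradient f x \<bullet> b" .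
  next
    fix k
    show "(\<lambda>x. (f (x + inverse (real (Suc k)) *\<^sub>R b) - f x) / inverse (real (Suc k)))
        \<in> borel_measurable borel"
      using f measurable_compose[OF _ f] by measurable
  qed
  then show ?thesis
    by (subst borel_measurable_euclidean_space) simp
qed

lemma borel_measurable_grad_matrix:
  fixes f :: "'n::finite \<Rightarrow> real^'d::finite \<Rightarrow> real"
  assumes "\<And>j x. f j differentiable (at x)"
  shows "grad_matrix f \<in> borel_measurable borel"
proof (subst borel_measurable_euclidean_space, rule ballI)
  fix b :: "real^'n^'d" assume "b \<in> Basis"
  then obtain i j where b: "b = axis i (axis j 1)"
    by (auto simp: Basis_vec_def)
  have "(\<lambda>x. gradient (f j) x \<bullet> axis i 1) \<in> borel_measurable borel"
    using borel_measurable_gradient[OF assms] by measurable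
  then show "(\<lambda>x. grad_matrix f x \<bullet> b) \<in> borel_measurable borel"
    by (simp add: b inner_axis grad_matrix_def)
qed

lemma borel_measurable_row_sum:
  "g \<in> borel_measurable M \<Longrightarrow> (\<lambda>w. (g w :: real^'n::finite^'d::finite) *v vec 1) \<in> borel_measurable M"
proof (erule measurable_compose)
  have "linear (\<lambda>X :: real^'n^'d. X *v vec 1)"
    by (rule linearI) (simp_all add: matrix_vector_mult_add_rdistrib scaleR_matrix_vector_assoc)
  then show "(\<lambda>X :: real^'n^'d. X *v vec 1) \<in> borel_measurable borel"
    by (intro borel_measurable_continuous_onI linear_continuous_on) (simp add: linear_linear)
qed

lemma measurable_gjs_step:
  fixes f :: "'n::finite \<Rightarrow> real^'d::finite \<Rightarrow> real"
  assumes diff: "\<And>j x. f j differentiable (at x)"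
    and pr: "prox_well_defined \<alpha> \<psi>" "\<alpha> > 0" "ereal_convex \<psi>"
    and s: "s \<in> measurable M borel" and p: "p \<in> measurable M (borel \<Otimes>\<^sub>M borel)"
  shows "(\<lambda>w. gjs_step f \<psi> \<alpha> (s w) (p w)) \<in> measurable M borel"
proof -
  have x: "(\<lambda>w. fst (s w)) \<in> borel_measurable M"
    by (rule measurable_compose[OF s]) (intro borel_measurable_continuous_onI continuous_intros)
  have J: "(\<lambda>w. snd (s w)) \<in> borel_measurable M"
    by (rule measurable_compose[OF s]) (intro borel_measurable_continuous_onI continuous_intros)
  have S: "(\<lambda>w. fst (p w)) \<in> measurable M borel" and U: "(\<lambda>w. snd (p w)) \<in> measurable M borel"
    using p by measurable
  have G: "(\<lambda>w. grad_matrix f (fst (s w))) \<in> borel_measurable M"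
    by (rule measurable_compose[OF x borel_measurable_grad_matrix[OF diff]])
  have P: "prox \<alpha> \<psi> \<in> borel_measurable borel"
    using continuous_on_prox[OF pr] by (rule borel_measurable_continuous_onI)
  have "(\<lambda>w. gjs_estimator f (snd (p w)) (fst (s w)) (snd (s w))) \<in> borel_measurable M"
    unfolding gjs_estimator_def
    by (intro borel_measurable_add borel_measurable_scaleR borel_measurable_const
        borel_measurable_row_sum measurable_blinfun_apply_at borel_measurable_diff U J G)
  then have "(\<lambda>w. prox \<alpha> \<psi> (fst (s w) - \<alpha> *\<^sub>R gjs_estimator f (snd (p w)) (fst (s w)) (snd (s w))))
      \<in> borel_measurable M"
    by (intro measurable_compose[OF _ P] borel_measurable_diff borel_measurable_scaleR x borel_measurable_const)
  moreover have "(\<lambda>w. snd (s w) - blinfun_apply (fst (p w)) (snd (s w) - grad_matrix f (fst (s w))))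
      \<in> borel_measurable M"
    by (intro borel_measurable_diff measurable_blinfun_apply_at S J G)
  ultimately show ?thesis
    unfolding gjs_step_def case_prod_beta by (rule borel_measurable_Pair)
qed

lemma gjs_cong:
  "(\<And>i. i < k \<Longrightarrow> S i = S' i \<and> U i = U' i) \<Longrightarrow> gjs f \<psi> \<alpha> x0 J0 S U k = gjs f \<psi> \<alpha> x0 J0 S' U' k"
  by (induction k) auto

lemma measurable_gjs:
  fixes f :: "'n::finite \<Rightarrow> real^'d::finite \<Rightarrow> real"
  assumes diff: "\<And>j x. f j differentiable (at x)"
    and pr: "prox_well_defined \<alpha> \<psi>" "\<alpha> > 0" "ereal_convex \<psi>"
  shows "k \<le> m \<Longrightarrow> (\<lambda>y. gjs f \<psi> \<alpha> x0 J0 (\<lambda>i. fst (y i)) (\<lambda>i. snd (y i)) k)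
    \<in> measurable (PiM {..<m} (\<lambda>_. borel \<Otimes>\<^sub>M borel)) borel"
proof (induction k)
  case (Suc k)
  then show ?case
    unfolding gjs_Suc prod.collapse
    by (intro measurable_gjs_step[OF diff pr] measurable_component_singleton) auto
qed simp

text \<open>Freezing the first variable and averaging over the second one replaces conditional
  expectations.\<close>

lemma (in prob_space) nn_integral_indep_pair:
  assumes ind: "indep_var N X L Y" and h: "h \<in> borel_measurable (N \<Otimes>\<^sub>M L)"
  shows "(\<integral>\<^sup>+w. h (X w, Y w) \<partial>M) = (\<integral>\<^sup>+w. (\<integral>\<^sup>+v. h (X w, Y v) \<partial>M) \<partial>M)"
proof -
  have X: "X \<in> measurable M N" and Y: "Y \<in> measurable M L"
    and eq: "distr M N X \<Otimes>\<^sub>M distr M L Y = distr M (N \<Otimes>\<^sub>M L) (\<lambda>w. (X w, Y w))"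
    using ind by (simp_all add: indep_var_distribution_eq)
  interpret Y: prob_space "distr M L Y" by (rule prob_space_distr[OF Y])
  have h': "h \<in> borel_measurable (distr M N X \<Otimes>\<^sub>M distr M L Y)"
    using h by (simp cong: measurable_cong_sets)
  have "(\<integral>\<^sup>+w. h (X w, Y w) \<partial>M) = (\<integral>\<^sup>+z. h z \<partial>distr M (N \<Otimes>\<^sub>M L) (\<lambda>w. (X w, Y w)))"
    by (rule nn_integral_distr[symmetric]) (use X Y h in measurable)
  also have "\<dots> = (\<integral>\<^sup>+x. (\<integral>\<^sup>+p. h (x, p) \<partial>distr M L Y) \<partial>distr M N X)"
    unfolding eq[symmetric] by (rule Y.nn_integral_fst[OF h', symmetric])
  also have "\<dots> = (\<integral>\<^sup>+w. (\<integral>\<^sup>+p. h (X w, p) \<partial>distr M L Y) \<partial>M)"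
    by (rule nn_integral_distr[OF X]) (use Y.borel_measurable_nn_integral_fst[OF h'] in simp)
  also have "\<dots> = (\<integral>\<^sup>+w. (\<integral>\<^sup>+v. h (X w, Y v) \<partial>M) \<partial>M)"
  proof (rule nn_integral_cong)
    fix w assume "w \<in> space M"
    then have "X w \<in> space N" using X by (rule measurable_space[rotated])
    then have "(\<lambda>p. h (X w, p)) \<in> borel_measurable L"
      using measurable_compose[OF measurable_Pair1' h] by simp
    then show "(\<integral>\<^sup>+p. h (X w, p) \<partial>distr M L Y) = (\<integral>\<^sup>+v. h (X w, Y v) \<partial>M)"
      using nn_integral_distr[OF Y] by simp
  qed
  finally show ?thesis .
qed

section \<open>Linear convergence\<close>

context gjs_assumptions
begin

lemma measurable_lyapunov: "\<Psi> \<in> borel_measurable borel"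
proof -
  have c: "continuous_on UNIV (\<lambda>X. B (Mdh X))"
    using linear_BM by (intro linear_continuous_on) (simp add: linear_linear)
  have "continuous_on UNIV (\<lambda>s :: (real^'d) \<times> (real^'n^'d).
      (norm (fst s - xs))\<^sup>2 + \<alpha> * (norm (B (Mdh (snd s - G xs))))\<^sup>2)"
    by (intro continuous_intros continuous_on_compose2[OF c]) auto
  then have "continuous_on UNIV \<Psi>"
    using lyapunov_eq[of "fst s" "snd s" for s] by simp
  then show ?thesis by (rule borel_measurable_continuous_onI)
qed

lemma gjs_in_affine_range: "fst (gjs f \<psi> \<alpha> x0 J0 S' U' k) \<in> affine_range x0 W"
proof (cases k)
  case 0
  show ?thesis unfolding 0 affine_range_def by (auto intro: exI[of _ 0])
next
  case (Suc m)
  then show ?thesis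
    using prox_contraction_W(1)[OF prox alpha psi W psi_off]
    by (simp add: gjs_Suc gjs_step_def case_prod_beta del: gjs.simps(2))
qed

text \<open>The state after \<open>k\<close> steps is a function of the operators with index below \<open>k\<close> and hence
  independent of the pair with index \<open>k\<close>, which has the law of \<open>(S, U)\<close>. Freezing the state, the
  expected decrease in one step applies; working with nonnegative integrals yields integrability along
  with the bound.\<close>

lemma linear_convergence:
  fixes P :: "'w measure" and Sk Uk :: "nat \<Rightarrow> 'w \<Rightarrow> ('d, 'n) matrix_op" and J0
  assumes SU: "(\<lambda>w. (S w, U w)) \<in> measurable D (borel \<Otimes>\<^sub>M borel)"
    and P: "prob_space P"
    and indep: "prob_space.indep_vars P (\<lambda>_. borel \<Otimes>\<^sub>M borel) (\<lambda>k w. (Sk k w, Uk k w)) UNIV"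
    and law: "\<And>k. distr P (borel \<Otimes>\<^sub>M borel) (\<lambda>w. (Sk k w, Uk k w))
                = distr D (borel \<Otimes>\<^sub>M borel) (\<lambda>w. (S w, U w))"
  defines "st \<equiv> \<lambda>k w. gjs f \<psi> \<alpha> x0 J0 (\<lambda>i. Sk i w) (\<lambda>i. Uk i w) k"
  shows "integrable P (\<lambda>w. \<Psi> (st k w))
    \<and> integral\<^sup>L P (\<lambda>w. \<Psi> (st k w)) \<le> (1 - \<alpha> * \<sigma>) ^ k * \<Psi> (x0, J0)"
proof -
  interpret P: prob_space P by fact
  define X where "X k w = (Sk k w, Uk k w)" for k w
  note indep = indep[folded X_def] and law = law[folded X_def]
  let ?c = "1 - \<alpha> * \<sigma>"
  have X: "X k \<in> measurable P (borel \<Otimes>\<^sub>M borel)" for k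
    using indep by (simp add: P.indep_vars_def)
  \<comment> \<open>Both random variables in \<open>indep_var\<close> must have values in the same type, so the current pair is
    kept as a sequence with a single index.\<close>
  define past where "past k w = restrict (\<lambda>i. X i w) {..<k}" for k w
  define now where "now k w = restrict (\<lambda>i. X i w) {k}" for k w
  define F where "F k y = gjs f \<psi> \<alpha> x0 J0 (\<lambda>i. fst (y i)) (\<lambda>i. snd (y i)) k" for k y
  let ?Past = "\<lambda>k. PiM {..<k} (\<lambda>_. borel \<Otimes>\<^sub>M borel) :: (nat \<Rightarrow> ('d, 'n) matrix_op \<times> ('d, 'n) matrix_op) measure"
  let ?Now = "\<lambda>k. PiM {k} (\<lambda>_. borel \<Otimes>\<^sub>M borel) :: (nat \<Rightarrow> ('d, 'n) matrix_op \<times> ('d, 'n) matrix_op) measure"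
  have F: "F k \<in> measurable (?Past k) borel" for k
    unfolding F_def by (rule measurable_gjs[OF diff prox alpha psi order.refl])
  have ind: "P.indep_var (?Past k) (past k) (?Now k) (now k)" for k
    unfolding past_def now_def by (rule P.indep_var_restrict[OF indep]) auto
  have st_F: "st k w = F k (past k w)" for k w
    by (auto simp: F_def st_def X_def past_def intro!: gjs_cong)
  have past: "past k \<in> measurable P (?Past k)" for k
    using ind by (simp add: P.indep_var_distribution_eq)
  have st: "st k \<in> borel_measurable P" for k
    using measurable_compose[OF past F, of k] by (simp add: st_F[symmetric])
  have in_L: "fst (st k w) \<in> affine_range x0 W" for k w
    unfolding st_def by (rule gjs_in_affine_range)
  have St: "st (Suc k) w = gjs_step f \<psi> \<alpha> (F k (past k w)) (now k w k)" for k w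
    by (simp only: st_F[symmetric]) (simp only: st_def X_def gjs_Suc now_def restrict_apply singletonI if_True)
  have mstep: "(\<lambda>z. ennreal (\<Psi> (gjs_step f \<psi> \<alpha> (F k (fst z)) (snd z k))))
      \<in> borel_measurable (?Past k \<Otimes>\<^sub>M ?Now k)" for k
    by (intro measurable_compose[OF _ measurable_ennreal] measurable_compose[OF _ measurable_lyapunov]
        measurable_gjs_step[OF diff prox alpha psi] measurable_compose[OF measurable_fst F]
        measurable_compose[OF measurable_snd measurable_component_singleton]) auto
  have step: "(\<integral>\<^sup>+w. ennreal (\<Psi> (st (Suc k) w)) \<partial>P) \<le> (\<integral>\<^sup>+w. ennreal (?c * \<Psi> (st k w)) \<partial>P)" for k
  proof -
    have h: "(\<lambda>p. ennreal (\<Psi> (gjs_step f \<psi> \<alpha> s p))) \<in> borel_measurable (borel \<Otimes>\<^sub>M borel)" for s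
      by (intro measurable_compose[OF _ measurable_ennreal]
          measurable_compose[OF _ measurable_lyapunov]
          measurable_gjs_step[OF diff prox alpha psi]) auto
    have inner: "(\<integral>\<^sup>+v. ennreal (\<Psi> (gjs_step f \<psi> \<alpha> s (X k v))) \<partial>P)
        = (\<integral>\<^sup>+v. ennreal (\<Psi> (gjs_step f \<psi> \<alpha> s (S v, U v))) \<partial>D)" for s
    proof -
      have "(\<integral>\<^sup>+v. ennreal (\<Psi> (gjs_step f \<psi> \<alpha> s (X k v))) \<partial>P)
          = (\<integral>\<^sup>+p. ennreal (\<Psi> (gjs_step f \<psi> \<alpha> s p)) \<partial>distr P (borel \<Otimes>\<^sub>M borel) (X k))"
        by (rule nn_integral_distr[OF X, symmetric]) (use h in simp)
      also have "\<dots> = (\<integral>\<^sup>+v. ennreal (\<Psi> (gjs_step f \<psi> \<alpha> s (S v, U v))) \<partial>D)"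
        unfolding law by (rule nn_integral_distr[OF SU]) (use h in simp)
      finally show ?thesis .
    qed
    have "(\<integral>\<^sup>+w. ennreal (\<Psi> (st (Suc k) w)) \<partial>P)
        = (\<integral>\<^sup>+w. (\<integral>\<^sup>+v. ennreal (\<Psi> (gjs_step f \<psi> \<alpha> (st k w) (X k v))) \<partial>P) \<partial>P)"
      using P.nn_integral_indep_pair[OF ind mstep, of k] by (simp add: St st_F[of k] now_def)
    also have "\<dots> \<le> (\<integral>\<^sup>+w. ennreal (?c * \<Psi> (st k w)) \<partial>P)"
      unfolding inner by (intro nn_integral_mono one_step_nn_integral(1) in_L)
    finally show ?thesis .
  qed
  have m: "(\<lambda>w. \<Psi> (st k w)) \<in> borel_measurable P" for k
    by (rule measurable_compose[OF st measurable_lyapunov])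
  have main: "integrable P (\<lambda>w. \<Psi> (st k w)) \<and> P.expectation (\<lambda>w. \<Psi> (st k w)) \<le> ?c ^ k * \<Psi> (x0, J0)
      \<and> 0 \<le> ?c ^ k * \<Psi> (x0, J0)" for k
  proof (induction k)
    case 0
    then show ?case
      using lyapunov_nonneg by (simp add: st_def P.prob_space)
  next
    case (Suc k)
    let ?E = "\<lambda>k. P.expectation (\<lambda>w. \<Psi> (st k w))"
    have int: "integrable P (\<lambda>w. ?c * \<Psi> (st k w))"
      using Suc by simp
    have nn: "0 \<le> ?c * \<Psi> (st k w)" for w
      by (rule one_step_nn_integral(2)[OF in_L])
    have le: "(\<integral>\<^sup>+w. ennreal (\<Psi> (st (Suc k) w)) \<partial>P) \<le> ennreal (?c * ?E k)"
      using step[of k] nn_integral_eq_integral[OF int] nn by simp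
    have int': "integrable P (\<lambda>w. \<Psi> (st (Suc k) w))"
      using lyapunov_nonneg m le_less_trans[OF le ennreal_less_top]
      by (intro integrableI_nonneg) auto
    have Ek: "0 \<le> ?c * ?E k"
      using Bochner_Integration.integral_nonneg[of P "\<lambda>w. ?c * \<Psi> (st k w)"] nn by simp
    have "ennreal (?E (Suc k)) \<le> ennreal (?c * ?E k)"
      using le nn_integral_eq_integral[OF int'] lyapunov_nonneg by simp
    then have E: "?E (Suc k) \<le> ?c * ?E k"
      using Ek by simp
    \<comment> \<open>The factor may be negative, but then \<open>\<Psi>\<close> vanishes at the start, by nonnegativity.\<close>
    have c0: "0 \<le> ?c * \<Psi> (x0, J0)"
      using one_step_nn_integral(2)[OF in_L[of 0]] by (simp add: st_def)
    have "?c * ?E k \<le> ?c * (?c ^ k * \<Psi> (x0, J0)) \<and> 0 \<le> ?c * (?c ^ k * \<Psi> (x0, J0))"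
    proof (cases "0 \<le> ?c")
      case True
      then show ?thesis
        using Suc lyapunov_nonneg by (intro conjI mult_left_mono mult_nonneg_nonneg) auto
    next
      case False
      then have "\<Psi> (x0, J0) = 0"
        using c0 lyapunov_nonneg[of "(x0, J0)"] by (simp add: zero_le_mult_iff)
      moreover have "0 \<le> ?E k"
        by (rule Bochner_Integration.integral_nonneg) (rule lyapunov_nonneg)
      then have "?c * ?E k \<le> 0"
        using False by (simp add: mult_le_0_iff)
      ultimately show ?thesis by simp
    qed
    then show ?case using E int' by simp
  qed
  then show ?thesis by simp
qed

end

theorem theoremE1:
  fixes f :: "'n::finite \<Rightarrow> real^'d::finite \<Rightarrow> real"
    and A :: "'n \<Rightarrow> real^'d^'d"
    and \<psi> \<psi>' :: "real^'d \<Rightarrow> ereal"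
    and xs x0 :: "real^'d"
    and J0 :: "real^'n^'d"
    and W :: "real^'d^'d"
    and \<sigma>' \<alpha> :: real
    and B :: "real^'n^'d \<Rightarrow> real^'n^'d"
    and D :: "'s measure"
    and S U :: "'s \<Rightarrow> ('d, 'n) matrix_op"
    and P :: "'w measure"
    and Sk Uk :: "nat \<Rightarrow> 'w \<Rightarrow> ('d, 'n) matrix_op"
  defines "Mdh \<equiv> psd_sqrt (pinv (columnwise_op A))"
  assumes psd: "\<And>j. psd_matrix (A j)"
    and convex: "\<And>j. convex_on UNIV (f j)"
    and diff: "\<And>j x. f j differentiable (at x)"
    and smooth: "\<And>j. smooth_wrt (A j) (f j)"
    and psi: "ereal_convex \<psi>"
    and minimizer: "is_arg_min (\<lambda>x. ereal (average f x) + \<psi> x) (\<lambda>_. True) xs"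
    and W: "projection_matrix W"
    and psi': "ereal_convex \<psi>'"
    and psi_on: "\<And>x. x \<in> affine_range x0 W \<Longrightarrow> \<psi> x = \<psi>' x"
    and psi_off: "\<And>x. x \<notin> affine_range x0 W \<Longrightarrow> \<psi> x = \<infinity>"
    and strong: "strongly_convex_over \<sigma>' (affine_range x0 W) (average f)"
    and alpha: "\<alpha> > 0"
    and prox: "prox_well_defined \<alpha> \<psi>"
    \<comment> \<open>the random pair of operators\<close>
    and D: "prob_space D"
    and SU_measurable: "(\<lambda>\<omega>. (S \<omega>, U \<omega>)) \<in> measurable D (borel \<Otimes>\<^sub>M borel)"
    and S_proj: "\<And>\<omega>. \<omega> \<in> space D \<Longrightarrow> orth_projection (blinfun_apply (S \<omega>))"
    and U_integrable: "\<And>X. integrable D (\<lambda>\<omega>. blinfun_apply (U \<omega>) X)"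
    and U_mean: "op_expectation D U = id"
    \<comment> \<open>fresh independent copies of the pair\<close>
    and P: "prob_space P"
    and indep: "prob_space.indep_vars P (\<lambda>_. borel \<Otimes>\<^sub>M borel) (\<lambda>k \<omega>. (Sk k \<omega>, Uk k \<omega>)) UNIV"
    and same_law: "\<And>k. distr P (borel \<Otimes>\<^sub>M borel) (\<lambda>\<omega>. (Sk k \<omega>, Uk k \<omega>))
                      = distr D (borel \<Otimes>\<^sub>M borel) (\<lambda>\<omega>. (S \<omega>, U \<omega>))"
    and M_commutes: "\<And>\<omega>. \<omega> \<in> space D \<Longrightarrow> Mdh \<circ> blinfun_apply (S \<omega>) = blinfun_apply (S \<omega>) \<circ> Mdh"
    and B_linear: "linear B"
    and B_commutes: "\<And>\<omega>. \<omega> \<in> space D \<Longrightarrow> B \<circ> blinfun_apply (S \<omega>) = blinfun_apply (S \<omega>) \<circ> B"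
    \<comment> \<open>the expectations in the two inequalities below are finite\<close>
    and U_sq_integrable:
      "\<And>X. integrable D (\<lambda>\<omega>. sqnorm W (blinfun_apply (U \<omega>) X *v vec 1))"
    and ineq1: "\<And>X. 2 * \<alpha> / (real CARD('n))\<^sup>2
                     * integral\<^sup>L D (\<lambda>\<omega>. sqnorm W (blinfun_apply (U \<omega>) X *v vec 1))
                   + (norm (psd_sqrt (\<lambda>Y. Y - op_expectation D S Y) (B (Mdh X))))\<^sup>2
                   \<le> (1 - \<alpha> * \<sigma>') * (norm (B (Mdh X)))\<^sup>2"
    and ineq2: "\<And>X. 2 * \<alpha> / (real CARD('n))\<^sup>2
                     * integral\<^sup>L D (\<lambda>\<omega>. sqnorm W (blinfun_apply (U \<omega>) X *v vec 1))
                   + (norm (psd_sqrt (op_expectation D S) (B (Mdh X))))\<^sup>2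
                   \<le> 1 / real CARD('n) * (norm (Mdh X))\<^sup>2"
  defines "\<Psi> \<equiv> \<lambda>k \<omega>. gjs_lyapunov A B f \<alpha> xs
                        (gjs f \<psi> \<alpha> x0 J0 (\<lambda>i. Sk i \<omega>) (\<lambda>i. Uk i \<omega>) k)"
  shows "\<forall>k. integrable P (\<Psi> k) \<and>
           integral\<^sup>L P (\<Psi> k) \<le> (1 - \<alpha> * \<sigma>') ^ k * gjs_lyapunov A B f \<alpha> xs (x0, J0)"
proof -
  interpret D: prob_space D by (rule D)
  have Sm: "S \<in> measurable D borel"
    using measurable_compose[OF SU_measurable measurable_fst] by simp
  have SX: "(\<lambda>\<omega>. blinfun_apply (S \<omega>) X) \<in> borel_measurable D" for X
    by (rule measurable_blinfun_apply_at[OF Sm]) simp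
  interpret gjs_assumptions D S U f A \<psi> xs x0 W \<sigma>' \<alpha> B Mdh
    by (intro gjs_assumptions.intro gjs_assumptions_axioms.intro random_projection.intro
        random_projection_axioms.intro) (fact assms SX | simp add: Mdh_def)+
  show ?thesis
    unfolding \<Psi>_def by (intro allI linear_convergence SU_measurable P indep same_law)
qed

end
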